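(* Let $m\le d$ be positive integers, $n=m+d$, $\mathcal U=[0,1]^d$, and let $\mathbf f=(f_1,\dots,f_m):\mathcal U\to\mathbb R^m$ be such that all partial derivatives $\partial \mathbf f/\partial\alpha_i$ and $\partial^2\mathbf f/\partial\alpha_i\partial\alpha_j$ exist and are continuous on $\mathcal U$, and suppose there is $\eta>0$ such that for all $\boldsymbol\alpha\in\mathcal U$ $$\left|\det\left(\frac{\partial^2 f_j}{\partial\alpha_1\partial\alpha_i}(\boldsymbol\alpha)\right)_{1\le i\le m,\,1\le j\le m}\right|\ge\eta .$$ Then there is a constant $C>0$ (depending on $\mathbf f$, $n$, $d$, but independent of $q$, $\boldsymbol\theta$ and $\psi$) such that for every $\boldsymbol\theta\in\mathbb R^n$, every function $\psi:[0,\infty)\to[0,\infty)$ with $\psi(r)\to0$ as $r\to\infty$, and every $q\in\mathbb N$ with $0<\psi(q)\le 1/2$, $$A(q,\psi,\boldsymbol\theta)\le C\left(\psi(q)^m q^d+(q\psi(q))^{-1/2}q^d\max\{1,\log(q\psi(q))\}\right).$$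
   Context: For $\boldsymbol\theta=(\boldsymbol\lambda,\boldsymbol\gamma)\in\mathbb R^d\times\mathbb R^m$ and $q\in\mathbb N$, let $$\mathcal R(q,\psi,\boldsymbol\theta)=\left\{(\mathbf a,\mathbf b)\in\mathbb Z^d\times\mathbb Z^m:\ \tfrac{\mathbf a+\boldsymbol\lambda}{q}\in\mathcal U,\ \left|q\mathbf f\!\left(\tfrac{\mathbf a+\boldsymbol\lambda}{q}\right)-\boldsymbol\gamma-\mathbf b\right|<\psi(q)\right\},$$ where $|\cdot|$ is the sup norm on $\mathbb R^m$, and $A(q,\psi,\boldsymbol\theta)=\#\mathcal R(q,\psi,\boldsymbol\theta)$. *)

theory Defs
  imports "HOL-Analysis.Analysis"
begin

(* The slice of S through x in direction i is used as the domain of differentiation, so on the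
   faces of a cube the derivatives are the one-sided ones. *)
definition partial_differentiable ::
  "(real^'d) set \<Rightarrow> 'd \<Rightarrow> (real^'d \<Rightarrow> 'b::real_normed_vector) \<Rightarrow> real^'d \<Rightarrow> bool"
where
  "partial_differentiable S i g x \<longleftrightarrow>
     (\<lambda>t. g (x + t *\<^sub>R axis i 1)) differentiable (at 0 within {t. x + t *\<^sub>R axis i 1 \<in> S})"

definition partial_deriv ::
  "(real^'d) set \<Rightarrow> 'd \<Rightarrow> (real^'d \<Rightarrow> 'b::real_normed_vector) \<Rightarrow> real^'d \<Rightarrow> 'b"
where
  "partial_deriv S i g x =
     vector_derivative (\<lambda>t. g (x + t *\<^sub>R axis i 1)) (at 0 within {t. x + t *\<^sub>R axis i 1 \<in> S})"

definition C2_partials_on ::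
  "(real^'d) set \<Rightarrow> (real^'d \<Rightarrow> 'b::real_normed_vector) \<Rightarrow> bool"
where
  "C2_partials_on S g \<longleftrightarrow>
     (\<forall>i. (\<forall>x\<in>S. partial_differentiable S i g x) \<and> continuous_on S (partial_deriv S i g)) \<and>
     (\<forall>i j. (\<forall>x\<in>S. partial_differentiable S i (partial_deriv S j g) x) \<and>
            continuous_on S (partial_deriv S i (partial_deriv S j g)))"

abbreviation unit_cube :: "(real^'d) set" where
  "unit_cube \<equiv> cbox 0 1"

definition of_int_vec :: "int^'k \<Rightarrow> real^'k" where
  "of_int_vec a = (\<chi> i. of_int (a $ i))"

definition shifted_point :: "nat \<Rightarrow> real^'d \<Rightarrow> int^'d \<Rightarrow> real^'d" where
  "shifted_point q l a = (1 / real q) *\<^sub>R (of_int_vec a + l)"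

(* infnorm is the sup norm on real^'m. *)
definition near_points ::
  "(real^'d \<Rightarrow> real^'m) \<Rightarrow> nat \<Rightarrow> (real \<Rightarrow> real) \<Rightarrow> (real^'d) \<times> (real^'m) \<Rightarrow> ((int^'d) \<times> (int^'m)) set"
where
  "near_points f q \<psi> \<theta> =
     {(a, b). shifted_point q (fst \<theta>) a \<in> unit_cube \<and>
              infnorm (real q *\<^sub>R f (shifted_point q (fst \<theta>) a) - snd \<theta> - of_int_vec b) < \<psi> (real q)}"

definition near_count ::
  "(real^'d \<Rightarrow> real^'m) \<Rightarrow> nat \<Rightarrow> (real \<Rightarrow> real) \<Rightarrow> (real^'d) \<times> (real^'m) \<Rightarrow> nat"
where
  "near_count f q \<psi> \<theta> = card (near_points f q \<psi> \<theta>)"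

lemma finite_int_vec_box:
  fixes S :: "'k::finite \<Rightarrow> int set"
  assumes "\<And>i. finite (S i)"
  shows "finite {a::int^'k. \<forall>i. a $ i \<in> S i}"
proof (rule finite_subset)
  show "{a::int^'k. \<forall>i. a $ i \<in> S i} \<subseteq> vec_lambda ` (PiE UNIV S)"
  proof
    fix a :: "int^'k" assume "a \<in> {a. \<forall>i. a $ i \<in> S i}"
    then have "vec_nth a \<in> PiE UNIV S" by auto
    then show "a \<in> vec_lambda ` (PiE UNIV S)" by (metis image_eqI vec_nth_inverse)
  qed
  show "finite ((vec_lambda :: _ \<Rightarrow> int^'k) ` (PiE UNIV S))"
    by (intro finite_imageI finite_PiE) (use assms in auto)
qed

(* Hence card in near_count never takes its default value 0 for infinite sets. *)
lemma finite_near_points: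
  fixes f :: "real^'d \<Rightarrow> real^'m"
  assumes "q \<ge> 1"
  shows "finite (near_points f q \<psi> \<theta>)"
proof -
  obtain l c where \<theta>: "\<theta> = (l, c)" by (cases \<theta>)
  let ?p = "shifted_point q l"
  let ?A = "{a::int^'d. \<forall>i. a $ i \<in> {\<lfloor>- l $ i\<rfloor>..\<lceil>real q - l $ i\<rceil>}}"
  let ?B = "\<lambda>a. {b::int^'m. \<forall>j. b $ j \<in>
      {\<lfloor>real q * f (?p a) $ j - c $ j - \<psi> (real q)\<rfloor>..\<lceil>real q * f (?p a) $ j - c $ j + \<psi> (real q)\<rceil>}}"
  have q: "real q > 0" using assms by simp
  have "near_points f q \<psi> \<theta> \<subseteq> Sigma ?A ?B"
  proof (rule subrelI, intro SigmaI CollectI allI)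
    fix a b i assume "(a, b) \<in> near_points f q \<psi> \<theta>"
    then have "?p a \<in> cbox 0 1" by (simp add: near_points_def \<theta>)
    then have "0 \<le> (of_int (a $ i) + l $ i) / real q" "(of_int (a $ i) + l $ i) / real q \<le> 1"
      by (auto simp: mem_box_cart shifted_point_def of_int_vec_def divide_inverse mult.commute)
    then have "0 \<le> of_int (a $ i) + l $ i" "of_int (a $ i) + l $ i \<le> real q"
      using q by (auto simp: zero_le_divide_iff divide_le_eq)
    then show "a $ i \<in> {\<lfloor>- l $ i\<rfloor>..\<lceil>real q - l $ i\<rceil>}"
      by (simp; linarith)
  next
    fix a b j assume "(a, b) \<in> near_points f q \<psi> \<theta>"
    then have "infnorm (real q *\<^sub>R f (?p a) - c - of_int_vec b) < \<psi> (real q)"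
      by (simp add: near_points_def \<theta>)
    then have "\<bar>real q * f (?p a) $ j - c $ j - of_int (b $ j)\<bar> < \<psi> (real q)"
      using component_le_infnorm_cart[of "real q *\<^sub>R f (?p a) - c - of_int_vec b" j]
      by (simp add: of_int_vec_def)
    then show "b $ j \<in>
      {\<lfloor>real q * f (?p a) $ j - c $ j - \<psi> (real q)\<rfloor>..\<lceil>real q * f (?p a) $ j - c $ j + \<psi> (real q)\<rceil>}"
      by (simp; linarith)
  qed
  moreover have "finite (Sigma ?A ?B)"
    by (intro finite_SigmaI finite_int_vec_box) auto
  ultimately show ?thesis by (rule finite_subset)
qed

end

(*
  A Fejer-type majorant bounds the count by the main term plus exponential sums of q h.f(x) over the
  shifted lattice points x in the cube, with integer frequencies h ~= 0 of size at most 1/psi(q).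
  By the determinant condition some mixed derivative d_1 d_i (h.f) is at least c |h|. Hence the second
  derivative of h.f along one of the directions e_1, e_i, e_1 + e_i is at least a multiple of |h|, and
  the same direction serves on a whole cell of a fixed subdivision of the cube. Summing along the
  lattice lines in that direction, van der Corput's second derivative test (from the Kusmin-Landau
  inequality) bounds each line by O((q |h|)^(1/2)) <= O((q/psi)^(1/2)), so the logarithm is not needed.
  If q psi(q) < 1, the trivial bound suffices.
*)
theory Submission
  imports Defs
begin

section \<open>Exponential sums with monotone differences\<close>

text \<open>Only iterated partial derivatives along the axes are available, so curvature is carried
  by second differences: van der Corput's test needs nothing else, and one-dimensional mean value
  theorems express the differences by mixed partials. The direction e_1 + e_i comes from
  polarization: its second derivative is twice the mixed one plus the two pure ones, so it is large
  when the mixed one is large and both pure ones are small.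

  Directions with entries 0 and 1 make a lattice line nondecreasing in every coordinate. Hence it is
  enough that a cell contains the box between any two of its points: the line then meets the cell in
  consecutive lattice points. The subdivision can be fixed before h because the lower bound and the
  oscillation of the second derivatives of h.f both scale with |h|.

  The majorant is |sum_k e(k.y)|^2 over a box of vectors k. Divided by the squared number of terms,
  it averages over the frequencies k - k', so a bound uniform in the frequency reaches the count
  unchanged and no sum over frequencies remains.\<close>

definition ee :: "real \<Rightarrow> complex" where
  "ee x = cis (2 * pi * x)"

lemma norm_ee [simp]: "norm (ee x) = 1"
  by (simp add: ee_def)

lemma ee_add: "ee (x + y) = ee x * ee y"
  by (simp add: ee_def cis_mult algebra_simps)

lemma cnj_ee: "cnj (ee x) = ee (- x)"
  by (simp add: ee_def cis_cnj)

lemma ee_of_int [simp]: "ee (of_int n) = 1"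
  unfolding ee_def by (rule cis_multiple_2pi) simp

lemma ee_add_int: "ee (x + of_int n) = ee x"
  by (simp add: ee_add)

section \<open>The Kusmin-Landau inequality\<close>

lemma sin_pi_ge:
  assumes "0 < \<theta>" "\<theta> \<le> t" "t \<le> 1 - \<theta>"
  shows "sin (pi * t) \<ge> \<theta>"
proof -
  \<comment> \<open>Concavity would give \<open>2 * s\<close>. The weaker constant needs only cos >=
    1/2 on [0, pi/3], together with pi / 2 >= 1, and sin >= sqrt 3 / 2 >= 1/2 on the rest of
    [0, pi/2].\<close>
  have main: "sin (pi * s) \<ge> s" if s: "0 \<le> s" "s \<le> 1/2" for s :: real
  proof (cases "s \<le> 1/3")
    case True
    have "\<exists>x\<in>{0..pi * s}. sin (pi * s) - sin 0 = cos x * (pi * s - 0)"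
      by (rule mvt_very_simple[where f' = "\<lambda>x h. cos x * h"])
        (use s in \<open>auto intro!: derivative_eq_intros\<close>)
    then obtain x where x: "0 \<le> x" "x \<le> pi * s" "sin (pi * s) = cos x * (pi * s)" by auto
    have "x \<le> pi / 3" using x(2) mult_left_mono[OF True, of pi] pi_ge_zero by linarith
    then have "cos (pi / 3) \<le> cos x" using x(1) by (intro cos_monotone_0_pi_le) auto
    then have "1 / 2 * (pi * s) \<le> sin (pi * s)"
      unfolding x(3) using s by (intro mult_right_mono) (auto simp: cos_60)
    moreover have "2 * s \<le> pi * s" using s pi_gt3 by (intro mult_right_mono) auto
    ultimately show ?thesis by simp
  next
    case False
    have "sin (pi / 3) \<le> sin (pi * s)"
      using False s mult_left_mono[of "1/3" s pi] mult_left_mono[of s "1/2" pi]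
      by (intro sin_monotone_2pi_le) (auto simp: order_trans[of _ 0])
    moreover have "1 \<le> sqrt 3" by simp
    ultimately show ?thesis using s unfolding sin_60 by linarith
  qed
  show ?thesis
  proof (cases "t \<le> 1/2")
    case False
    have "sin (pi * t) = sin (pi * (1 - t))" by (simp add: right_diff_distrib)
    then show ?thesis using main[of "1 - t"] False assms by linarith
  qed (use main[of t] assms in linarith)
qed

text \<open>The value \<open>1 / (ee t - 1)\<close>, written with the cotangent so that its variation telescopes.\<close>

definition kl :: "real \<Rightarrow> complex" where
  "kl t = Complex (- 1/2) (- cot (pi * t) / 2)"

lemma kl_inverse:
  assumes "0 < t" "t < 1"
  shows "(ee t - 1) * kl t = 1"
proof -
  define x where "x = pi * t"
  have s: "sin x > 0" using assms unfolding x_def by (intro sin_gt_zero) auto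
  \<comment> \<open>\<open>Complex (- sin x) (cos x)\<close> is i times \<open>cis x\<close>: here
    the value splits into its modulus 2 sin x and a unit vector, and below \<open>kl t\<close>
    splits into the reciprocal modulus and the conjugate vector.\<close>
  have "ee t - 1 = Complex (2 * sin x) 0 * Complex (- sin x) (cos x)"
    by (simp add: complex_eq_iff ee_def mult.assoc flip: x_def)
      (simp add: cos_double_sin sin_double power2_eq_square)
  moreover have "kl t = Complex (1 / (2 * sin x)) 0 * Complex (- sin x) (- cos x)"
    using s by (simp add: complex_eq_iff kl_def cot_def flip: x_def)
  ultimately have "(ee t - 1) * kl t = (Complex (2 * sin x) 0 * Complex (1 / (2 * sin x)) 0)
      * (Complex (- sin x) (cos x) * Complex (- sin x) (- cos x))"
    by (simp only: mult_ac)
  also have "Complex (2 * sin x) 0 * Complex (1 / (2 * sin x)) 0 = 1"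
    using s by (simp add: complex_eq_iff)
  also have "Complex (- sin x) (cos x) * Complex (- sin x) (- cos x) = 1"
    using sin_cos_squared_add[of x] by (simp add: complex_eq_iff power2_eq_square)
  finally show ?thesis by simp
qed

lemma norm_kl:
  assumes "0 < \<theta>" "\<theta> \<le> t" "t \<le> 1 - \<theta>"
  shows "norm (kl t) \<le> 1 / (2 * \<theta>)" "\<bar>cot (pi * t)\<bar> \<le> 1 / \<theta>"
proof -
  define x where "x = pi * t"
  have s: "sin x \<ge> \<theta>" unfolding x_def by (rule sin_pi_ge[OF assms])
  then have s0: "sin x > 0" using assms(1) by linarith
  have "kl t = of_real (1 / (2 * sin x)) * (- \<i> * cis (- x))"
    using s0 by (simp add: complex_eq_iff kl_def cot_def flip: x_def)
  then have "norm (kl t) = \<bar>1 / (2 * sin x)\<bar>" by (simp only: norm_mult norm_of_real norm_cis) simp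
  also have "\<dots> = 1 / (2 * sin x)" using s0 by simp
  also have "\<dots> \<le> 1 / (2 * \<theta>)" using s s0 assms(1) by (intro divide_left_mono) auto
  finally show "norm (kl t) \<le> 1 / (2 * \<theta>)" .
  have "\<bar>cot x\<bar> = \<bar>cos x\<bar> / sin x" using s0 by (simp add: cot_def)
  also have "\<dots> \<le> 1 / \<theta>" using s assms(1) by (intro frac_le) auto
  finally show "\<bar>cot (pi * t)\<bar> \<le> 1 / \<theta>" by (simp add: x_def)
qed

lemma cot_antimono:
  assumes "0 < s" "s \<le> t" "t < 1"
  shows "cot (pi * t) \<le> cot (pi * s)"
proof -
  have "sin (pi * s) > 0" "sin (pi * t) > 0" using assms by (auto intro!: sin_gt_zero)
  moreover have "sin (pi * (t - s)) \<ge> 0"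
    using assms by (intro sin_ge_zero mult_nonneg_nonneg) auto
  then have "sin (pi * t - pi * s) \<ge> 0" by (simp only: right_diff_distrib)
  ultimately show ?thesis by (simp add: cot_def sin_diff field_simps)
qed

lemma norm_kl_diff:
  assumes "0 < s" "s \<le> t" "t < 1"
  shows "norm (kl t - kl s) = (cot (pi * s) - cot (pi * t)) / 2"
proof -
  have "kl t - kl s = \<i> * of_real ((cot (pi * s) - cot (pi * t)) / 2)"
    by (simp add: kl_def complex_eq_iff field_simps)
  then show ?thesis using cot_antimono[OF assms] by (simp only: norm_mult norm_of_real) simp
qed

text \<open>Each term is a first difference of \<open>ee (g k)\<close> times \<open>c k\<close> = 1
  / (ee (t k) - 1), so partial summation leaves two boundary terms and the variation of
  \<open>c\<close>. The values \<open>c k\<close> lie on the line Re = -1/2 and move along it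
  monotonically as \<open>t k\<close> increases, so the variation is the distance of the end values,
  at most 1 / \<theta>.\<close>

lemma kusmin_landau:
  fixes g :: "nat \<Rightarrow> real" and n :: int and \<theta> :: real
  assumes \<theta>: "0 < \<theta>"
    and rng: "\<And>k. a \<le> k \<Longrightarrow> k < b \<Longrightarrow> real_of_int n + \<theta> \<le> g (Suc k) - g k \<and> g (Suc k) - g k \<le> real_of_int n + 1 - \<theta>"
    and mono: "\<And>k. a \<le> k \<Longrightarrow> Suc k < b \<Longrightarrow> g (Suc k) - g k \<le> g (Suc (Suc k)) - g (Suc k)"
  shows "norm (\<Sum>k=a..<b. ee (g k)) \<le> 2 / \<theta>"
proof (cases "a < b")
  case True
  define t where "t k = g (Suc k) - g k - n" for k
  define c where "c k = kl (t k)" for k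
  have t: "\<theta> \<le> t k" "t k \<le> 1 - \<theta>" if "a \<le> k" "k < b" for k
    using rng[OF that] by (auto simp: t_def)
  have tmono: "t k \<le> t (Suc k)" if "a \<le> k" "Suc k < b" for k
    using mono[OF that] by (auto simp: t_def)
  have z: "ee (g k) = (ee (g (Suc k)) - ee (g k)) * c k" if "a \<le> k" "k < b" for k
  proof -
    have "g (Suc k) = g k + t k + of_int n" by (simp add: t_def)
    then have "ee (g (Suc k)) = ee (g k) * ee (t k)" by (simp only: ee_add ee_of_int mult_1_right)
    then have "(ee (g (Suc k)) - ee (g k)) * c k = ee (g k) * ((ee (t k) - 1) * kl (t k))"
      by (simp add: c_def algebra_simps)
    then show ?thesis using kl_inverse[of "t k"] t[OF that] \<theta> by simp
  qed
  \<comment> \<open>Partial summation as an invariant: the boundary term at the right end stays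
    inside the norm, so that each further step costs only the increment of \<open>c\<close>.\<close>
  have "norm ((\<Sum>k=a..<Suc m. ee (g k)) - ee (g (Suc m)) * c m)
          \<le> norm (c a) + (cot (pi * t a) - cot (pi * t m)) / 2" if "a \<le> m" "m < b" for m
    using that
  proof (induction m rule: dec_induct)
    case base
    then have "ee (g a) - ee (g (Suc a)) * c a = - (ee (g a) * c a)"
      using z[of a] True by (simp add: algebra_simps)
    then show ?case by (simp add: norm_mult)
  next
    case (step m)
    have "(\<Sum>k=a..<Suc (Suc m). ee (g k)) - ee (g (Suc (Suc m))) * c (Suc m)
        = ((\<Sum>k=a..<Suc m. ee (g k)) - ee (g (Suc m)) * c m) - ee (g (Suc m)) * (c (Suc m) - c m)"
      using z[of "Suc m"] step by (simp add: algebra_simps)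
    then have "norm ((\<Sum>k=a..<Suc (Suc m). ee (g k)) - ee (g (Suc (Suc m))) * c (Suc m))
        \<le> norm ((\<Sum>k=a..<Suc m. ee (g k)) - ee (g (Suc m)) * c m) + norm (c (Suc m) - c m)"
      using norm_triangle_ineq4[of "(\<Sum>k=a..<Suc m. ee (g k)) - ee (g (Suc m)) * c m" "ee (g (Suc m)) * (c (Suc m) - c m)"]
      by (simp only: norm_mult norm_ee mult_1)
    moreover have "norm (c (Suc m) - c m) = (cot (pi * t m) - cot (pi * t (Suc m))) / 2"
      unfolding c_def
      using step t[of m] t[of "Suc m"] tmono[of m] \<theta> by (intro norm_kl_diff) auto
    ultimately show ?case using step by (simp add: field_simps)
  qed
  from this[of "b - 1"] True
  have "norm ((\<Sum>k=a..<b. ee (g k)) - ee (g b) * c (b - 1))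
          \<le> norm (c a) + (cot (pi * t a) - cot (pi * t (b - 1))) / 2" by simp
  moreover have "norm (\<Sum>k=a..<b. ee (g k)) \<le> norm ((\<Sum>k=a..<b. ee (g k)) - ee (g b) * c (b - 1)) + norm (c (b - 1))"
    using norm_triangle_sub[of "\<Sum>k=a..<b. ee (g k)" "ee (g b) * c (b - 1)"] by (simp add: norm_mult)
  moreover have "norm (c a) \<le> 1 / (2 * \<theta>)" "\<bar>cot (pi * t a)\<bar> \<le> 1 / \<theta>"
    using norm_kl[OF \<theta> t[of a]] True by (simp_all add: c_def)
  moreover have "norm (c (b - 1)) \<le> 1 / (2 * \<theta>)" "\<bar>cot (pi * t (b - 1))\<bar> \<le> 1 / \<theta>"
    using norm_kl[OF \<theta> t[of "b - 1"]] True by (simp_all add: c_def)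
  moreover have "1 / (2 * \<theta>) + 1 / (2 * \<theta>) + (1 / \<theta> + 1 / \<theta>) / 2 = 2 / \<theta>"
    using \<theta> by (simp add: field_simps)
  ultimately show ?thesis unfolding abs_le_iff by argo
qed (use \<theta> in simp)

section \<open>Van der Corput's second derivative test\<close>

lemma order_convex_nat_set:
  fixes A :: "nat set"
  assumes "finite A" "\<And>x y z. x \<in> A \<Longrightarrow> z \<in> A \<Longrightarrow> x \<le> y \<Longrightarrow> y \<le> z \<Longrightarrow> y \<in> A"
  obtains a b where "A = {a..<b}"
proof (cases "A = {}")
  case False
  then have "A = {Min A..<Suc (Max A)}"
  proof (intro equalityI subsetI)
    fix y assume "y \<in> {Min A..<Suc (Max A)}"
    then show "y \<in> A" using assms(2)[of "Min A" "Max A" y] assms(1) False by simp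
  qed (use assms(1) in \<open>simp add: less_Suc_eq_le\<close>)
  then show ?thesis by (rule that)
qed (use that[of 0 0] in simp)

text \<open>Serves for the indices whose difference \<delta> is too close to an integer for
  Kusmin-Landau: growing by at least \<mu> per step, \<delta> leaves a window of length r after r /
  \<mu> steps.\<close>

lemma card_le_of_separated:
  fixes A :: "nat set" and \<delta> :: "nat \<Rightarrow> real"
  assumes "finite A" "\<mu> > 0" "r \<ge> 0"
    and sep: "\<And>i j. i \<in> A \<Longrightarrow> j \<in> A \<Longrightarrow> i \<le> j \<Longrightarrow> \<mu> * (real j - real i) \<le> \<delta> j - \<delta> i"
    and rng: "\<And>i. i \<in> A \<Longrightarrow> x \<le> \<delta> i \<and> \<delta> i \<le> x + r"
  shows "real (card A) \<le> r / \<mu> + 1"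
proof (cases "A = {}")
  case False
  have M: "Min A \<in> A" "Max A \<in> A" "Min A \<le> Max A" using assms(1) False by auto
  have "A \<subseteq> {Min A..Max A}" using assms(1) by auto
  from card_mono[OF _ this] have "card A \<le> Suc (Max A) - Min A" by simp
  then have "real (card A) \<le> real (Max A) - real (Min A) + 1" using M by linarith
  moreover have "\<mu> * (real (Max A) - real (Min A)) \<le> r"
    using sep[OF M] rng[OF M(1)] rng[OF M(2)] by linarith
  then have "real (Max A) - real (Min A) \<le> r / \<mu>" using assms(2) by (simp add: field_simps)
  ultimately show ?thesis by linarith
qed (use assms in simp)

lemma second_diff_sum:
  fixes g :: "nat \<Rightarrow> real"
  assumes sd: "\<And>k. k + 2 < N \<Longrightarrow> \<mu> \<le> g (k + 2) - 2 * g (k + 1) + g k \<and> g (k + 2) - 2 * g (k + 1) + g k \<le> M"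
    and "i \<le> j" "Suc j < N"
  shows "\<mu> * (real j - real i) \<le> (g (Suc j) - g j) - (g (Suc i) - g i)"
    and "(g (Suc j) - g j) - (g (Suc i) - g i) \<le> M * (real j - real i)"
proof -
  have "\<mu> * (real j - real i) \<le> (g (Suc j) - g j) - (g (Suc i) - g i)
      \<and> (g (Suc j) - g j) - (g (Suc i) - g i) \<le> M * (real j - real i)"
    using assms(2,3)
  proof (induction j rule: dec_induct)
    case (step n)
    then show ?case using sd[of n] by (simp add: algebra_simps)
  qed simp
  then show "\<mu> * (real j - real i) \<le> (g (Suc j) - g j) - (g (Suc i) - g i)"
    "(g (Suc j) - g j) - (g (Suc i) - g i) \<le> M * (real j - real i)" by auto
qed

lemma norm_sum_ee_le_card: "norm (\<Sum>k\<in>A. ee (g k)) \<le> real (card A)"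
  using sum_norm_le[of A "\<lambda>k. ee (g k)" "\<lambda>_. 1"] by simp

text \<open>The differences \<delta> increase by at most M N in total, so their floors take at most
  M N + 2 values. For a fixed floor, the indices with \<delta> within \<theta> of an end of the unit
  interval are counted trivially, at most \<theta> / \<mu> + 1 at each end, and Kusmin-Landau gives
  2 / \<theta> for the others. The choice \<theta> = sqrt \<mu> balances \<theta> / \<mu> against 1
  / \<theta>.\<close>

lemma van_der_corput_nat:
  fixes g :: "nat \<Rightarrow> real"
  assumes \<mu>: "\<mu> > 0"  "M \<ge> 0"
    and sd: "\<And>k. k + 2 < N \<Longrightarrow> \<mu> \<le> g (k + 2) - 2 * g (k + 1) + g k \<and> g (k + 2) - 2 * g (k + 1) + g k \<le> M"
  shows "norm (\<Sum>k<N. ee (g k)) \<le> (M * N + 2) * (4 / sqrt \<mu> + 3)"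
proof (cases N)
  case 0
  then show ?thesis using \<mu> by (simp add: add_nonneg_nonneg)
next
  case (Suc n)
  define \<delta> where "\<delta> k = g (Suc k) - g k" for k
  define \<theta> where "\<theta> = sqrt \<mu>"
  have \<theta>: "\<theta> > 0" "\<theta> / \<mu> = 1 / \<theta>" using \<mu> by (auto simp: \<theta>_def divide_simps)
  have sep: "\<mu> * (real j - real i) \<le> \<delta> j - \<delta> i" "\<delta> j - \<delta> i \<le> M * (real j - real i)"
    if "i \<le> j" "j < n" for i j
    using second_diff_sum[OF sd that(1)] that(2) Suc by (auto simp: \<delta>_def)
  have mono: "\<delta> i \<le> \<delta> j" if "i \<le> j" "j < n" for i j
  proof -
    have "0 \<le> \<mu> * (real j - real i)" using \<mu>(1) that(1) by simp
    then show ?thesis using sep(1)[OF that] by linarith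
  qed
  define Z where "Z = (\<lambda>k. \<lfloor>\<delta> k\<rfloor>) ` {..<n}"
  have Z: "real (card Z) \<le> M * N + 2"
  proof (cases "n = 0")
    case False
    have "Z \<subseteq> {\<lfloor>\<delta> 0\<rfloor>..\<lfloor>\<delta> (n - 1)\<rfloor>}" using mono by (auto simp: Z_def intro!: floor_mono)
    from card_mono[OF _ this] have "card Z \<le> nat (\<lfloor>\<delta> (n - 1)\<rfloor> + 1 - \<lfloor>\<delta> 0\<rfloor>)" by simp
    moreover have "\<lfloor>\<delta> 0\<rfloor> \<le> \<lfloor>\<delta> (n - 1)\<rfloor>" using mono[of 0 "n - 1"] False by (simp add: floor_mono)
    ultimately have "real (card Z) \<le> \<delta> (n - 1) - \<delta> 0 + 2" by linarith
    also have "\<delta> (n - 1) - \<delta> 0 \<le> M * (real (n - 1) - real 0)" using sep(2)[of 0 "n - 1"] False by simp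
    also have "\<dots> \<le> M * N" using \<mu>(2) Suc by (intro mult_left_mono) auto
    finally show ?thesis by simp
  qed (use \<mu> in \<open>simp add: Z_def\<close>)
  have fib: "norm (\<Sum>k\<in>{k\<in>{..<n}. \<lfloor>\<delta> k\<rfloor> = z}. ee (g k)) \<le> 4 / \<theta> + 2" for z
  proof -
    define I where "I = {k\<in>{..<n}. \<lfloor>\<delta> k\<rfloor> = z}"
    \<comment> \<open>\<open>L\<close> and \<open>H\<close> are the margins near the two integers,
      \<open>K\<close> the range of Kusmin-Landau. For \<theta> > 1/2 the margins cover everything
      and \<open>K\<close> is empty, so large \<mu> needs no separate case.\<close>
    define L where "L = {k\<in>I. \<delta> k < real_of_int z + \<theta>}"
    define H where "H = {k\<in>I. real_of_int z + \<theta> \<le> \<delta> k \<and> real_of_int z + 1 - \<theta> < \<delta> k}"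
    define K where "K = {k\<in>I. real_of_int z + \<theta> \<le> \<delta> k \<and> \<delta> k \<le> real_of_int z + 1 - \<theta>}"
    have fin: "finite I" by (simp add: I_def)
    have IU: "I = (L \<union> H) \<union> K" "(L \<union> H) \<inter> K = {}" by (auto simp: L_def H_def K_def)
    have "real (card L) \<le> \<theta> / \<mu> + 1"
      by (rule card_le_of_separated[where \<delta> = \<delta> and x = z])
        (use \<mu> \<theta> sep fin in \<open>auto simp: L_def I_def\<close>)
    moreover have "real (card H) \<le> \<theta> / \<mu> + 1"
    proof (rule card_le_of_separated[where \<delta> = \<delta> and x = "real_of_int z + 1 - \<theta>"])
      fix i assume "i \<in> H"
      then show "real_of_int z + 1 - \<theta> \<le> \<delta> i \<and> \<delta> i \<le> real_of_int z + 1 - \<theta> + \<theta>"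
        unfolding H_def I_def by simp linarith
    qed (use \<mu> \<theta> sep fin in \<open>auto simp: H_def I_def\<close>)
    moreover have "card (L \<union> H) \<le> card L + card H" by (rule card_Un_le)
    ultimately have "real (card (L \<union> H)) \<le> 2 * (1 / \<theta> + 1)" using \<theta> by simp
    with norm_sum_ee_le_card[of g "L \<union> H"]
    have LH: "norm (\<Sum>k\<in>L \<union> H. ee (g k)) \<le> 2 * (1 / \<theta> + 1)" by linarith
    have finK: "finite K" using fin by (simp add: K_def)
    have "y \<in> K" if "x \<in> K" "w \<in> K" "x \<le> y" "y \<le> w" for x y w
    proof -
      have "\<delta> x \<le> \<delta> y" "\<delta> y \<le> \<delta> w" using that mono by (auto simp: K_def I_def)
      then have "\<lfloor>\<delta> x\<rfloor> \<le> \<lfloor>\<delta> y\<rfloor>" "\<lfloor>\<delta> y\<rfloor> \<le> \<lfloor>\<delta> w\<rfloor>" by (auto intro: floor_mono)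
      then show ?thesis using that \<open>\<delta> x \<le> \<delta> y\<close> \<open>\<delta> y \<le> \<delta> w\<close> by (auto simp: K_def I_def)
    qed
    with finK obtain a b where K: "K = {a..<b}" by (rule order_convex_nat_set)
    have KI: "k < n \<and> real_of_int z + \<theta> \<le> \<delta> k \<and> \<delta> k \<le> real_of_int z + 1 - \<theta>" if "a \<le> k" "k < b" for k
      using that K by (auto simp: K_def I_def set_eq_iff)
    have "norm (\<Sum>k=a..<b. ee (g k)) \<le> 2 / \<theta>"
    proof (rule kusmin_landau[OF \<theta>(1), where n = z])
      fix k assume "a \<le> k" "k < b"
      then show "real_of_int z + \<theta> \<le> g (Suc k) - g k \<and> g (Suc k) - g k \<le> real_of_int z + 1 - \<theta>"
        using KI[of k] by (simp add: \<delta>_def)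
    next
      fix k assume "a \<le> k" "Suc k < b"
      then show "g (Suc k) - g k \<le> g (Suc (Suc k)) - g (Suc k)"
        using KI[of "Suc k"] mono[of k "Suc k"] by (simp add: \<delta>_def)
    qed
    then have "norm (\<Sum>k\<in>K. ee (g k)) \<le> 2 / \<theta>" by (simp only: K)
    moreover have "(\<Sum>k\<in>I. ee (g k)) = (\<Sum>k\<in>L \<union> H. ee (g k)) + (\<Sum>k\<in>K. ee (g k))"

      unfolding IU(1) by (rule sum.union_disjoint) (use fin IU(2) finK in \<open>auto simp: L_def H_def\<close>)
    ultimately have "norm (\<Sum>k\<in>I. ee (g k)) \<le> 2 * (1 / \<theta> + 1) + 2 / \<theta>"
      using LH norm_triangle_ineq[of "\<Sum>k\<in>L \<union> H. ee (g k)" "\<Sum>k\<in>K. ee (g k)"] by simp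
    then show ?thesis unfolding I_def[symmetric] by simp
  qed
  have "(\<Sum>k<n. ee (g k)) = (\<Sum>z\<in>Z. \<Sum>k\<in>{k\<in>{..<n}. \<lfloor>\<delta> k\<rfloor> = z}. ee (g k))"
    unfolding Z_def by (rule sum.image_gen) simp
  also have "norm \<dots> \<le> (\<Sum>z\<in>Z. 4 / \<theta> + 2)" by (intro sum_norm_le fib)
  also have "\<dots> = card Z * (4 / \<theta> + 2)" by simp
  also have "\<dots> \<le> (M * N + 2) * (4 / \<theta> + 2)" using Z \<theta> by (intro mult_right_mono) auto
  finally have "norm (\<Sum>k<n. ee (g k)) \<le> (M * N + 2) * (4 / \<theta> + 2)" .
  \<comment> \<open>The last index has no following difference and is estimated by 1. As M N + 2 >=
    1, this turns the summand 2 of the other factor into 3.\<close>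
  moreover have "norm (\<Sum>k<N. ee (g k)) \<le> norm (\<Sum>k<n. ee (g k)) + 1"
    using norm_triangle_ineq[of "\<Sum>k<n. ee (g k)" "ee (g n)"] by (simp add: Suc)
  moreover have "1 \<le> M * N + 2" using \<mu> by simp
  ultimately show ?thesis by (simp add: \<theta>_def algebra_simps)
qed

text \<open>The sign s treats convex and concave phases alike: conjugating the sum replaces g by - g
  and keeps the norm.\<close>

lemma van_der_corput_int:
  fixes g :: "int \<Rightarrow> real"
  assumes \<mu>: "\<mu> > 0" "M \<ge> 0" and s: "\<bar>s\<bar> = 1" and T: "finite T"
    and conv: "\<And>x y z. x \<in> T \<Longrightarrow> z \<in> T \<Longrightarrow> x \<le> y \<Longrightarrow> y \<le> z \<Longrightarrow> y \<in> T"
    and sd: "\<And>t. t \<in> T \<Longrightarrow> t + 2 \<in> T \<Longrightarrow>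
      \<mu> \<le> s * (g (t + 2) - 2 * g (t + 1) + g t) \<and> s * (g (t + 2) - 2 * g (t + 1) + g t) \<le> M"
  shows "norm (\<Sum>t\<in>T. ee (g t)) \<le> (M * card T + 2) * (4 / sqrt \<mu> + 3)"
proof (cases "T = {}")
  case False
  define N where "N = card T"
  have "T = {Min T..Max T}"
  proof (intro equalityI subsetI)
    fix y assume "y \<in> {Min T..Max T}"
    then show "y \<in> T" using conv[of "Min T" "Max T" y] T False by simp
  qed (use T in simp)
  then obtain a b where T': "T = {a..b}" by blast
  have bij: "bij_betw (\<lambda>k. a + int k) {..<N} T"
  proof (rule bij_betwI[where g = "\<lambda>t. nat (t - a)"])
    show "(\<lambda>k. a + int k) \<in> {..<N} \<rightarrow> T" "(\<lambda>t. nat (t - a)) \<in> T \<rightarrow> {..<N}"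
      by (auto simp: N_def T')
  qed (auto simp: T')
  have mem: "a + int k \<in> T" if "k < N" for k
    using bij that by (auto simp: bij_betw_def)
  have *: "norm (\<Sum>k<N. ee (s * g (a + int k))) \<le> (M * N + 2) * (4 / sqrt \<mu> + 3)"
  proof (rule van_der_corput_nat[OF \<mu>])
    fix k assume "k + 2 < N"
    then have "a + int k \<in> T" "a + int k + 2 \<in> T" using mem[of k] mem[of "k + 2"] by (auto simp: add_ac)
    from sd[OF this]
    show "\<mu> \<le> s * g (a + int (k + 2)) - 2 * (s * g (a + int (k + 1))) + s * g (a + int k) \<and>
        s * g (a + int (k + 2)) - 2 * (s * g (a + int (k + 1))) + s * g (a + int k) \<le> M"
      by (simp add: algebra_simps)
  qed
  have "(\<Sum>k<N. ee (s * g (a + int k))) = (\<Sum>t\<in>T. ee (s * g t))"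
    by (rule sum.reindex_bij_betw[OF bij, where g = "\<lambda>t. ee (s * g t)"])
  moreover have "norm (\<Sum>t\<in>T. ee (s * g t)) = norm (\<Sum>t\<in>T. ee (g t))"
  proof -
    have "norm (\<Sum>t\<in>T. ee (- g t)) = norm (cnj (\<Sum>t\<in>T. ee (g t)))" by (simp only: cnj_ee cnj_sum)
    then have "norm (\<Sum>t\<in>T. ee (- g t)) = norm (\<Sum>t\<in>T. ee (g t))" by (simp only: complex_mod_cnj)
    moreover have "s = 1 \<or> s = -1" using s by auto
    ultimately show ?thesis by auto
  qed
  ultimately show ?thesis using * by (simp add: N_def)
qed (use \<mu> in \<open>simp add: add_nonneg_nonneg\<close>)

section \<open>Lattice lines in a box\<close>

lemma card_int_vec_box:
  fixes A :: "'k::finite \<Rightarrow> int set"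
  shows "card {a::int^'k. \<forall>i. a $ i \<in> A i} = (\<Prod>i\<in>UNIV. card (A i))"
proof -
  have "bij_betw vec_lambda (PiE UNIV A) {a::int^'k. \<forall>i. a $ i \<in> A i}"
    by (rule bij_betwI[where g = vec_nth]) (auto simp: vec_lambda_inverse vec_nth_inverse)
  then show ?thesis by (simp add: bij_betw_same_card[symmetric] card_PiE)
qed

text \<open>As the p-th entry of v is 1, every line in direction v has exactly one point with p-th
  coordinate 0, and that point labels the line. Counting the labels gives at most (2Q + 1)^(d-1)
  lines.\<close>

lemma sum_along_lines:
  fixes S :: "(int^'d) set" and F :: "int^'d \<Rightarrow> complex" and v lo :: "int^'d"
  assumes fin: "finite S" and p: "v $ p = 1" and v01: "\<And>i. v $ i \<in> {0, 1}"
    and rng: "\<And>a i. a \<in> S \<Longrightarrow> lo $ i \<le> a $ i \<and> a $ i \<le> lo $ i + int Q"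
    and Q: "Q \<ge> 1" and B: "B \<ge> 0"
    and line: "\<And>a. a \<in> S \<Longrightarrow> norm (\<Sum>t | a + t *s v \<in> S. F (a + t *s v)) \<le> B"
  shows "norm (\<Sum>a\<in>S. F a) \<le> (3 * real Q) ^ (CARD('d) - 1) * B"
proof -
  define \<pi> where "\<pi> a = a - (a $ p) *s v" for a :: "int^'d"
  \<comment> \<open>Coordinate i of a label is \<open>a $ i - a $ p * v $ i\<close>. Both
    coordinates of a range over intervals of length Q, so for \<open>v $ i\<close> in {0, 1} it
    stays within Q of the difference of their lower ends.\<close>
  define A where "A i = (if i = p then {0} else
      {lo $ i - v $ i * lo $ p - int Q .. lo $ i - v $ i * lo $ p + int Q})" for i
  have "\<pi> ` S \<subseteq> {a. \<forall>i. a $ i \<in> A i}"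
  proof (intro image_subsetI CollectI allI)
    fix a i assume a: "a \<in> S"
    show "\<pi> a $ i \<in> A i"
      using v01[of i] rng[OF a, of i] rng[OF a, of p] p by (auto simp: \<pi>_def A_def)
  qed
  moreover have finA: "finite {a::int^'d. \<forall>i. a $ i \<in> A i}"
    by (rule finite_int_vec_box) (simp add: A_def)
  ultimately have "card (\<pi> ` S) \<le> (\<Prod>i\<in>UNIV. card (A i))"
    using card_mono[OF finA] by (simp add: card_int_vec_box)
  also have "\<dots> = card (A p) * (\<Prod>i\<in>UNIV - {p}. card (A i))" by (rule prod.remove) auto
  also have "\<dots> = (2 * Q + 1) ^ (CARD('d) - 1)"
  proof -
    have "card (A i) = 2 * Q + 1" if "i \<in> UNIV - {p}" for i
      using that by (simp add: A_def)
    then show ?thesis by (simp add: A_def card_Diff_singleton)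
  qed
  also have "\<dots> \<le> (3 * Q) ^ (CARD('d) - 1)" using Q by (intro power_mono) auto
  finally have card: "real (card (\<pi> ` S)) \<le> (3 * real Q) ^ (CARD('d) - 1)"
    by (metis of_nat_le_iff of_nat_mult of_nat_numeral of_nat_power)
  have fib: "norm (\<Sum>a\<in>{a\<in>S. \<pi> a = y}. F a) \<le> B" if y: "y \<in> \<pi> ` S" for y
  proof -
    obtain a0 where a0: "a0 \<in> S" "y = \<pi> a0" using y by auto
    have bij: "bij_betw (\<lambda>t. a0 + t *s v) {t. a0 + t *s v \<in> S} {a\<in>S. \<pi> a = y}"
    proof (rule bij_betwI[where g = "\<lambda>a. a $ p - a0 $ p"])
      show "(\<lambda>t. a0 + t *s v) \<in> {t. a0 + t *s v \<in> S} \<rightarrow> {a\<in>S. \<pi> a = y}"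
        using p by (auto simp: a0 \<pi>_def vec_eq_iff algebra_simps)
      show *: "a0 + (a $ p - a0 $ p) *s v = a" if "a \<in> {a\<in>S. \<pi> a = y}" for a
        using that by (auto simp: a0 \<pi>_def vec_eq_iff algebra_simps)
      show "(\<lambda>a. a $ p - a0 $ p) \<in> {a\<in>S. \<pi> a = y} \<rightarrow> {t. a0 + t *s v \<in> S}"
        using * by auto
    qed (use p in auto)
    show ?thesis
      using line[OF a0(1)] by (simp add: sum.reindex_bij_betw[OF bij, where g = F])
  qed
  have "(\<Sum>a\<in>S. F a) = (\<Sum>y\<in>\<pi> ` S. \<Sum>a\<in>{a\<in>S. \<pi> a = y}. F a)"
    by (rule sum.image_gen[OF fin])
  also have "norm \<dots> \<le> (\<Sum>y\<in>\<pi> ` S. B)" by (intro sum_norm_le fib)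
  also have "\<dots> \<le> (3 * real Q) ^ (CARD('d) - 1) * B" using card B by (simp add: mult_right_mono)
  finally show ?thesis .
qed

lemma of_int_vec_nth [simp]: "of_int_vec a $ i = of_int (a $ i)"
  by (simp add: of_int_vec_def)

lemma shifted_point_nth: "shifted_point q l a $ i = (of_int (a $ i) + l $ i) / real q"
  by (simp add: shifted_point_def divide_inverse mult.commute)

lemma shifted_point_range:
  assumes "q \<ge> 1" "shifted_point q l a \<in> unit_cube"
  shows "\<lceil>- l $ i\<rceil> \<le> a $ i \<and> a $ i \<le> \<lceil>- l $ i\<rceil> + int q"
proof -
  have "0 \<le> (of_int (a $ i) + l $ i) / real q" "(of_int (a $ i) + l $ i) / real q \<le> 1"
    using assms(2) by (auto simp: mem_box_cart shifted_point_nth)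
  then have "0 \<le> of_int (a $ i) + l $ i" "of_int (a $ i) + l $ i \<le> real q"
    using assms(1) by (auto simp: zero_le_divide_iff divide_le_eq)
  then show ?thesis by linarith
qed

lemma finite_shifted_points:
  assumes "q \<ge> 1"
  shows "finite {a. shifted_point q l a \<in> unit_cube}" (is "finite ?S")
    and "real (card {a::int^'d. shifted_point q l a \<in> unit_cube}) \<le> (2 * real q) ^ CARD('d)"
proof -
  let ?A = "\<lambda>i. {\<lceil>- l $ i\<rceil> .. \<lceil>- l $ i\<rceil> + int q}"
  have sub: "?S \<subseteq> {a. \<forall>i. a $ i \<in> ?A i}" using shifted_point_range[OF assms] by auto
  have fin: "finite {a::int^'d. \<forall>i. a $ i \<in> ?A i}" by (rule finite_int_vec_box) simp
  show "finite ?S" by (rule finite_subset[OF sub fin])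
  have "card ?S \<le> (\<Prod>i\<in>(UNIV::'d set). q + 1)"
    using card_mono[OF fin sub] card_int_vec_box[of ?A] by (simp add: nat_add_distrib)
  also have "\<dots> = (q + 1) ^ CARD('d)" by simp
  also have "\<dots> \<le> (2 * q) ^ CARD('d)" using assms by (intro power_mono) auto
  finally show "real (card ?S) \<le> (2 * real q) ^ CARD('d)"
    by (metis of_nat_le_iff of_nat_mult of_nat_numeral of_nat_power)
qed

text \<open>Lattice neighbours on a line differ by v / q, so the phase q F has second differences
  between \<mu> / q and M / q: the factor q meets the square of the step 1 / q. A line has at most q
  + 1 <= 2 q points, so the number of unit intervals crossed by the first differences is bounded
  independently of q.\<close>

lemma exp_sum_cell:
  fixes B :: "(real^'d) set" and F :: "real^'d \<Rightarrow> real" and v :: "int^'d"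
  assumes q: "q \<ge> 1" and B: "B \<subseteq> unit_cube" and conv: "\<And>x y. x \<in> B \<Longrightarrow> y \<in> B \<Longrightarrow> cbox x y \<subseteq> B"
    and p: "v $ p = 1" and v01: "\<And>i. v $ i \<in> {0, 1}"
    and \<mu>: "\<mu> > 0" "M \<ge> 0" and s: "\<bar>s\<bar> = 1"
    and sd: "\<And>x u. u \<ge> 0 \<Longrightarrow> x \<in> B \<Longrightarrow> x + (2 * u) *\<^sub>R of_int_vec v \<in> B \<Longrightarrow>
      \<mu> * u\<^sup>2 \<le> s * (F (x + (2 * u) *\<^sub>R of_int_vec v) - 2 * F (x + u *\<^sub>R of_int_vec v) + F x) \<and>
      s * (F (x + (2 * u) *\<^sub>R of_int_vec v) - 2 * F (x + u *\<^sub>R of_int_vec v) + F x) \<le> M * u\<^sup>2"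
  shows "norm (\<Sum>a | shifted_point q l a \<in> B. ee (real q * F (shifted_point q l a)))
    \<le> (3 * real q) ^ (CARD('d) - 1) * ((2 * M + 2) * (4 * sqrt (real q / \<mu>) + 3))"
proof (rule sum_along_lines[where v = v and p = p and lo = "\<chi> i. \<lceil>- l $ i\<rceil>"])
  let ?S = "{a. shifted_point q l a \<in> B}"
  have SB: "?S \<subseteq> {a. shifted_point q l a \<in> unit_cube}" using B by auto
  show "finite ?S" by (rule finite_subset[OF SB finite_shifted_points(1)[OF q]])
  show rng: "(\<chi> i. \<lceil>- l $ i\<rceil>) $ i \<le> a $ i \<and> a $ i \<le> (\<chi> i. \<lceil>- l $ i\<rceil>) $ i + int q" if "a \<in> ?S" for a i
    using shifted_point_range[OF q, of l a i] that B by auto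
  fix a assume "a \<in> ?S"
  define T where "T = {t. a + t *s v \<in> ?S}"
  define g where "g t = real q * F (shifted_point q l (a + t *s v))" for t
  have "T \<subseteq> {\<lceil>- l $ p\<rceil> - a $ p .. \<lceil>- l $ p\<rceil> - a $ p + int q}"
    using rng[of "a + t *s v" p for t] p by (fastforce simp: T_def)
  from finite_subset[OF this] card_mono[OF _ this]
  have T: "finite T" "card T \<le> q + 1" by (auto simp: nat_add_distrib)
  have "norm (\<Sum>t\<in>T. ee (g t)) \<le> (M / q * card T + 2) * (4 / sqrt (\<mu> / q) + 3)"
  proof (rule van_der_corput_int[OF _ _ s T(1)])
    show "y \<in> T" if "x \<in> T" "z \<in> T" "x \<le> y" "y \<le> z" for x y z
    proof -
      \<comment> \<open>Here the entries of v must be nonnegative: the line is then monotone in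
        every coordinate, and a point between two others lies in their box.\<close>
      have "shifted_point q l (a + y *s v) \<in> cbox (shifted_point q l (a + x *s v)) (shifted_point q l (a + z *s v))"
        unfolding mem_box_cart
      proof
        fix i
        have "0 \<le> v $ i" using v01[of i] by auto
        then have "x * v $ i \<le> y * v $ i" "y * v $ i \<le> z * v $ i" using that by (auto intro: mult_right_mono)
        then have "real_of_int (x * v $ i) \<le> of_int (y * v $ i)" "real_of_int (y * v $ i) \<le> of_int (z * v $ i)"
          by (simp_all only: of_int_le_iff)
        then show "shifted_point q l (a + x *s v) $ i \<le> shifted_point q l (a + y *s v) $ i \<and>
          shifted_point q l (a + y *s v) $ i \<le> shifted_point q l (a + z *s v) $ i"
          using q by (simp add: shifted_point_nth divide_right_mono)
      qed
      then show ?thesis using conv that by (fastforce simp: T_def)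
    qed
    fix t assume t: "t \<in> T" "t + 2 \<in> T"
    define x where "x = shifted_point q l (a + t *s v)"
    have sp: "shifted_point q l (a + (t + 2) *s v) = x + (2 * (1 / real q)) *\<^sub>R of_int_vec v"
      "shifted_point q l (a + (t + 1) *s v) = x + (1 / real q) *\<^sub>R of_int_vec v"
      by (simp_all add: x_def vec_eq_iff shifted_point_nth add_divide_distrib algebra_simps)
    have "x \<in> B" "x + (2 * (1 / real q)) *\<^sub>R of_int_vec v \<in> B"
      using t sp by (auto simp: T_def x_def)
    from sd[OF _ this] have *: "\<mu> * (1 / real q)\<^sup>2 \<le> s * (F (x + (2 * (1 / real q)) *\<^sub>R of_int_vec v)
          - 2 * F (x + (1 / real q) *\<^sub>R of_int_vec v) + F x)"
       "s * (F (x + (2 * (1 / real q)) *\<^sub>R of_int_vec v) - 2 * F (x + (1 / real q) *\<^sub>R of_int_vec v) + F x)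
          \<le> M * (1 / real q)\<^sup>2" by auto
    have "real q * (c * (1 / real q)\<^sup>2) = c / q" for c
      using q by (simp add: power2_eq_square)
    with mult_left_mono[OF *(1), of "real q"] mult_left_mono[OF *(2), of "real q"]
    show "\<mu> / q \<le> s * (g (t + 2) - 2 * g (t + 1) + g t) \<and> s * (g (t + 2) - 2 * g (t + 1) + g t) \<le> M / q"
      unfolding g_def sp x_def[symmetric] by (simp add: algebra_simps)
  qed (use q \<mu> in auto)
  also have "\<dots> \<le> (2 * M + 2) * (4 * sqrt (real q / \<mu>) + 3)"
  proof (rule mult_mono[OF add_right_mono add_right_mono])
    have "M / q * card T \<le> M / q * (2 * q)"
      using T(2) q \<mu> by (intro mult_left_mono) auto
    then show "M / q * card T \<le> 2 * M" using q by simp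
    show "4 / sqrt (\<mu> / q) \<le> 4 * sqrt (real q / \<mu>)" by (simp add: real_sqrt_divide)
  qed (use \<mu> q in auto)
  finally show "norm (\<Sum>t | a + t *s v \<in> ?S. ee (real q * F (shifted_point q l (a + t *s v))))
      \<le> (2 * M + 2) * (4 * sqrt (real q / \<mu>) + 3)"
    by (simp add: T_def g_def)
qed (use q p v01 \<mu> in auto)

section \<open>Second differences of a twice differentiable map\<close>

text \<open>\<open>partial_deriv\<close> recentres the slice at each point, whereas the mean value
  theorem needs one parametrisation of the whole line. A translation of the parameter connects the
  two.\<close>

lemma partial_has_vector_derivative:
  assumes "partial_differentiable S i g (x + s *\<^sub>R axis i 1)"
  shows "((\<lambda>\<tau>. g (x + \<tau> *\<^sub>R axis i 1)) has_vector_derivative partial_deriv S i g (x + s *\<^sub>R axis i 1))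
    (at s within {\<tau>. x + \<tau> *\<^sub>R axis i 1 \<in> S})"
proof -
  let ?a = "axis i 1" and ?y = "x + s *\<^sub>R axis i 1"
  have "((\<lambda>\<tau>. g (?y + \<tau> *\<^sub>R ?a)) has_vector_derivative partial_deriv S i g ?y) (at 0 within {\<tau>. ?y + \<tau> *\<^sub>R ?a \<in> S})"
    using assms unfolding partial_differentiable_def partial_deriv_def
    by (simp add: vector_derivative_works)
  moreover have "(\<lambda>\<tau>. \<tau> - s) ` {\<tau>. x + \<tau> *\<^sub>R ?a \<in> S} \<subseteq> {\<tau>. ?y + \<tau> *\<^sub>R ?a \<in> S}"
    by (auto simp: algebra_simps)
  ultimately have outer: "((\<lambda>\<tau>. g (?y + \<tau> *\<^sub>R ?a)) has_derivative (\<lambda>h. h *\<^sub>R partial_deriv S i g ?y))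
      (at (s - s) within (\<lambda>\<tau>. \<tau> - s) ` {\<tau>. x + \<tau> *\<^sub>R ?a \<in> S})"
    unfolding has_vector_derivative_def by (simp add: has_derivative_subset)
  have "((\<lambda>\<tau>. \<tau> - s) has_derivative (\<lambda>h. h)) (at s within {\<tau>. x + \<tau> *\<^sub>R ?a \<in> S})"
    by (auto intro!: derivative_eq_intros)
  from has_derivative_in_compose[OF this outer]
  have "((\<lambda>\<tau>. g (?y + (\<tau> - s) *\<^sub>R ?a)) has_derivative (\<lambda>h. h *\<^sub>R partial_deriv S i g ?y))
      (at s within {\<tau>. x + \<tau> *\<^sub>R ?a \<in> S})" .
  then show ?thesis by (simp add: has_vector_derivative_def algebra_simps)
qed

lemma partial_inner_has_derivative:
  fixes g :: "real^'d \<Rightarrow> 'b::real_inner"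
  assumes "\<And>y. y \<in> S \<Longrightarrow> partial_differentiable S i g y"
    and "\<And>\<tau>. \<tau> \<in> T \<Longrightarrow> x + \<tau> *\<^sub>R axis i 1 \<in> S" and "s \<in> T"
  shows "((\<lambda>\<tau>. h \<bullet> g (x + \<tau> *\<^sub>R axis i 1)) has_derivative
      (\<lambda>\<tau>. \<tau> * (h \<bullet> partial_deriv S i g (x + s *\<^sub>R axis i 1)))) (at s within T)"
proof -
  have "((\<lambda>\<tau>. g (x + \<tau> *\<^sub>R axis i 1)) has_vector_derivative partial_deriv S i g (x + s *\<^sub>R axis i 1))
      (at s within T)"
    by (rule has_vector_derivative_within_subset[OF partial_has_vector_derivative]) (use assms in auto)
  from has_derivative_inner_right[OF this[unfolded has_vector_derivative_def], of h]
  show ?thesis by simp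
qed

text \<open>Applying the mean value theorem once in each direction avoids the symmetry of mixed partials.\<close>

lemma mixed_second_difference:
  fixes g :: "real^'d \<Rightarrow> 'b::real_inner"
  assumes diff1: "\<And>y. y \<in> S \<Longrightarrow> partial_differentiable S i g y"
    and diff2: "\<And>y. y \<in> S \<Longrightarrow> partial_differentiable S j (partial_deriv S i g) y"
    and "s \<ge> 0" "t \<ge> 0"
    and rect: "\<And>\<sigma> \<tau>. \<sigma> \<in> {0..s} \<Longrightarrow> \<tau> \<in> {0..t} \<Longrightarrow> x + \<sigma> *\<^sub>R axis j 1 + \<tau> *\<^sub>R axis i 1 \<in> S"
  shows "\<exists>\<sigma>\<in>{0..s}. \<exists>\<tau>\<in>{0..t}.
    h \<bullet> g (x + s *\<^sub>R axis j 1 + t *\<^sub>R axis i 1) - h \<bullet> g (x + s *\<^sub>R axis j 1) - h \<bullet> g (x + t *\<^sub>R axis i 1) + h \<bullet> g x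
      = s * t * (h \<bullet> partial_deriv S j (partial_deriv S i g) (x + \<sigma> *\<^sub>R axis j 1 + \<tau> *\<^sub>R axis i 1))"
proof -
  let ?D = "partial_deriv S i g"
  \<comment> \<open>\<open>?\<phi>\<close> compares two parallel segments in direction i. Its
    derivative is an increment of the first partial derivative along direction j, ready for the
    second mean value step.\<close>
  let ?\<phi> = "\<lambda>\<tau>. h \<bullet> g (x + s *\<^sub>R axis j 1 + \<tau> *\<^sub>R axis i 1) - h \<bullet> g (x + \<tau> *\<^sub>R axis i 1)"
  have der: "(?\<phi> has_derivative (\<lambda>y. y * (h \<bullet> ?D (x + s *\<^sub>R axis j 1 + \<tau> *\<^sub>R axis i 1)) - y * (h \<bullet> ?D (x + \<tau> *\<^sub>R axis i 1))))
      (at \<tau> within {0..t})" if "\<tau> \<in> {0..t}" for \<tau>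
    by (intro has_derivative_diff partial_inner_has_derivative diff1)
      (use that rect[of s] rect[of 0] assms(3) in auto)
  have "\<exists>\<tau>\<in>{0..t}. ?\<phi> t - ?\<phi> 0 =
      (t - 0) * (h \<bullet> ?D (x + s *\<^sub>R axis j 1 + \<tau> *\<^sub>R axis i 1)) - (t - 0) * (h \<bullet> ?D (x + \<tau> *\<^sub>R axis i 1))"
    by (rule mvt_very_simple[OF assms(4)]) (use der in auto)
  then obtain \<tau> where \<tau>: "\<tau> \<in> {0..t}" "?\<phi> t - ?\<phi> 0 =
      (t - 0) * (h \<bullet> ?D (x + s *\<^sub>R axis j 1 + \<tau> *\<^sub>R axis i 1)) - (t - 0) * (h \<bullet> ?D (x + \<tau> *\<^sub>R axis i 1))" by blast
  let ?y = "x + \<tau> *\<^sub>R axis i 1"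
  have "((\<lambda>\<sigma>. h \<bullet> ?D (?y + \<sigma> *\<^sub>R axis j 1)) has_derivative
      (\<lambda>z. z * (h \<bullet> partial_deriv S j ?D (?y + \<sigma> *\<^sub>R axis j 1)))) (at \<sigma> within {0..s})" if "\<sigma> \<in> {0..s}" for \<sigma>
    by (intro partial_inner_has_derivative diff2) (use that rect[of _ \<tau>] \<tau>(1) in \<open>auto simp: add_ac\<close>)
  then have "\<exists>\<sigma>\<in>{0..s}. h \<bullet> ?D (?y + s *\<^sub>R axis j 1) - h \<bullet> ?D (?y + 0 *\<^sub>R axis j 1)
      = (s - 0) * (h \<bullet> partial_deriv S j ?D (?y + \<sigma> *\<^sub>R axis j 1))"
    by (intro mvt_very_simple[OF assms(3)]) auto
  then obtain \<sigma> where \<sigma>: "\<sigma> \<in> {0..s}" "h \<bullet> ?D (?y + s *\<^sub>R axis j 1) - h \<bullet> ?D ?y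
      = s * (h \<bullet> partial_deriv S j ?D (?y + \<sigma> *\<^sub>R axis j 1))" by auto
  have "?\<phi> t - ?\<phi> 0 = t * (h \<bullet> ?D (?y + s *\<^sub>R axis j 1) - h \<bullet> ?D ?y)"
    using \<tau>(2) by (simp add: right_diff_distrib add_ac)
  also have "\<dots> = s * t * (h \<bullet> partial_deriv S j ?D (x + \<sigma> *\<^sub>R axis j 1 + \<tau> *\<^sub>R axis i 1))"
    unfolding \<sigma>(2) by (simp add: add_ac)
  finally show ?thesis using \<sigma>(1) \<tau>(1) by (intro bexI[of _ \<sigma>] bexI[of _ \<tau>]) auto
qed

section \<open>Choosing a direction of large curvature\<close>

lemma of_int_vec_axis: "of_int_vec (axis i 1) = axis i 1"
  by (simp add: vec_eq_iff axis_def)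

lemma of_int_vec_add: "of_int_vec (a + b) = of_int_vec a + of_int_vec b"
  by (simp add: vec_eq_iff)

lemma of_int_vec_diff: "of_int_vec (a - b) = of_int_vec a - of_int_vec b"
  by (simp add: vec_eq_iff)

text \<open>The sign of the reference value W fixes that of \<Delta>, since an error of half the
  lower bound for |W| still leaves the other half.\<close>

lemma sign_second_difference:
  fixes \<Delta> W c P u :: real
  assumes "\<bar>W\<bar> \<ge> c" "\<bar>\<Delta> - u\<^sup>2 * W\<bar> \<le> u\<^sup>2 * (c / 2)" "\<bar>\<Delta>\<bar> \<le> P * u\<^sup>2"
  shows "c / 2 * u\<^sup>2 \<le> (if W \<ge> 0 then 1 else -1) * \<Delta> \<and> (if W \<ge> 0 then 1 else -1) * \<Delta> \<le> P * u\<^sup>2"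
proof -
  have "u\<^sup>2 * c \<le> u\<^sup>2 * \<bar>W\<bar>" using assms(1) by (intro mult_left_mono) auto
  then show ?thesis using assms(2,3) by (auto simp: abs_if algebra_simps split: if_splits)
qed

lemma abs_sum_four_le:
  fixes a b c d r :: real
  assumes "\<bar>a\<bar> \<le> r" "\<bar>b\<bar> \<le> r" "\<bar>c\<bar> \<le> r" "\<bar>d\<bar> \<le> r"
  shows "\<bar>a + b + c + d\<bar> \<le> 4 * r"
  using assms by linarith

text \<open>If a pure derivative at z0 is at least c / 2 in absolute value, its axis serves.
  Otherwise the polarized value W = 2 G k l + G k k + G l l satisfies |W| >= 2 c - c / 2 - c / 2 =
  c, and e_k + e_l serves. The reference point z0 fixes direction and sign for all of B. The
  oscillation c / 16 is chosen because a diagonal second difference uses four values of G; the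
  factor 4 in the upper bound has the same origin.\<close>

lemma exists_curved_direction:
  fixes f :: "real^'d \<Rightarrow> real^'m" and h :: "real^'m"
  defines "G \<equiv> \<lambda>i j x. h \<bullet> partial_deriv unit_cube i (partial_deriv unit_cube j f) x"
  assumes C2: "C2_partials_on unit_cube f"
    and B: "B \<subseteq> unit_cube" and conv: "\<And>x y. x \<in> B \<Longrightarrow> y \<in> B \<Longrightarrow> cbox x y \<subseteq> B"
    and z0: "z0 \<in> B" and c: "c > 0" "\<bar>G k l z0\<bar> \<ge> c"
    and osc: "\<And>i j x. x \<in> B \<Longrightarrow> \<bar>G i j x - G i j z0\<bar> \<le> c / 16"
    and P: "\<And>i j x. x \<in> B \<Longrightarrow> \<bar>G i j x\<bar> \<le> P"
  obtains v :: "int^'d" and p s where "v $ p = 1" "\<And>i. v $ i \<in> {0, 1}" "\<bar>s::real\<bar> = 1"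
    "\<And>x u. u \<ge> 0 \<Longrightarrow> x \<in> B \<Longrightarrow> x + (2 * u) *\<^sub>R of_int_vec v \<in> B \<Longrightarrow>
      c / 4 * u\<^sup>2 \<le> s * (h \<bullet> f (x + (2 * u) *\<^sub>R of_int_vec v) - 2 * (h \<bullet> f (x + u *\<^sub>R of_int_vec v)) + h \<bullet> f x) \<and>
      s * (h \<bullet> f (x + (2 * u) *\<^sub>R of_int_vec v) - 2 * (h \<bullet> f (x + u *\<^sub>R of_int_vec v)) + h \<bullet> f x) \<le> 4 * P * u\<^sup>2"
proof -
  note direction = that
  have d1: "partial_differentiable unit_cube i f y" if "y \<in> unit_cube" for i y
    using C2 that by (simp add: C2_partials_on_def)
  have d2: "partial_differentiable unit_cube i (partial_deriv unit_cube j f) y" if "y \<in> unit_cube" for i j y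
    using C2 that by (simp add: C2_partials_on_def)
  have diff2: "\<exists>z\<in>B. h \<bullet> f (x + u *\<^sub>R axis j 1 + u *\<^sub>R axis i 1) - h \<bullet> f (x + u *\<^sub>R axis j 1)
      - h \<bullet> f (x + u *\<^sub>R axis i 1) + h \<bullet> f x = u\<^sup>2 * G j i z"
    if "u \<ge> 0" "x \<in> B" and y: "x + u *\<^sub>R axis j 1 + u *\<^sub>R axis i 1 \<in> B" for x u i j
  proof -
    have rect: "x + \<sigma> *\<^sub>R axis j 1 + \<tau> *\<^sub>R axis i 1 \<in> B" if "\<sigma> \<in> {0..u}" "\<tau> \<in> {0..u}" for \<sigma> \<tau>
      using conv[OF \<open>x \<in> B\<close> y] that by (auto simp: subset_iff mem_box_cart axis_def)
    then show ?thesis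
      using mixed_second_difference[OF d1 d2 that(1) that(1), of x j i h] B
      by (fastforce simp: G_def power2_eq_square)
  qed
  have approx: "\<bar>h \<bullet> f (x + u *\<^sub>R axis j 1 + u *\<^sub>R axis i 1) - h \<bullet> f (x + u *\<^sub>R axis j 1)
      - h \<bullet> f (x + u *\<^sub>R axis i 1) + h \<bullet> f x - u\<^sup>2 * G j i z0\<bar> \<le> u\<^sup>2 * (c / 16) \<and>
      \<bar>h \<bullet> f (x + u *\<^sub>R axis j 1 + u *\<^sub>R axis i 1) - h \<bullet> f (x + u *\<^sub>R axis j 1)
      - h \<bullet> f (x + u *\<^sub>R axis i 1) + h \<bullet> f x\<bar> \<le> P * u\<^sup>2"
    if xu: "u \<ge> 0" "x \<in> B" "x + u *\<^sub>R axis j 1 + u *\<^sub>R axis i 1 \<in> B" for x u i j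
  proof -
    obtain z where z: "z \<in> B" and eq: "h \<bullet> f (x + u *\<^sub>R axis j 1 + u *\<^sub>R axis i 1) - h \<bullet> f (x + u *\<^sub>R axis j 1)
      - h \<bullet> f (x + u *\<^sub>R axis i 1) + h \<bullet> f x = u\<^sup>2 * G j i z" using diff2[OF xu] by blast
    have "\<bar>u\<^sup>2 * G j i z - u\<^sup>2 * G j i z0\<bar> = u\<^sup>2 * \<bar>G j i z - G j i z0\<bar>"
      by (simp add: abs_mult flip: right_diff_distrib)
    also have "\<dots> \<le> u\<^sup>2 * (c / 16)" using osc[OF z] by (intro mult_left_mono) auto
    finally show ?thesis using P[OF z, of j i] unfolding eq
      by (simp add: abs_mult mult.commute mult_right_mono)
  qed
  have P0: "P \<ge> 0" using P[OF z0] by (metis abs_ge_zero order_trans)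
  \<comment> \<open>A pure second difference is the mixed one with both directions equal.\<close>
  have pure: thesis if i: "\<bar>G i i z0\<bar> \<ge> c / 2" for i
  proof (rule direction[of "axis i 1" i "if G i i z0 \<ge> 0 then 1 else -1"])
    fix x :: "real^'d" and u :: real assume xu: "u \<ge> 0" "x \<in> B" "x + (2 * u) *\<^sub>R of_int_vec (axis i 1) \<in> B"
    let ?\<Delta> = "h \<bullet> f (x + (2 * u) *\<^sub>R of_int_vec (axis i 1)) - 2 * (h \<bullet> f (x + u *\<^sub>R of_int_vec (axis i 1))) + h \<bullet> f x"
    have eq: "x + u *\<^sub>R axis i 1 + u *\<^sub>R axis i 1 = x + (2 * u) *\<^sub>R axis i 1"
      by (simp only: mult_2 scaleR_left_distrib add.assoc)
    have "x + u *\<^sub>R axis i 1 + u *\<^sub>R axis i 1 \<in> B" using xu(3) by (simp only: eq of_int_vec_axis)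
    from approx[OF xu(1,2) this]
    have *: "\<bar>?\<Delta> - u\<^sup>2 * G i i z0\<bar> \<le> u\<^sup>2 * (c / 16)" "\<bar>?\<Delta>\<bar> \<le> P * u\<^sup>2"
      unfolding eq of_int_vec_axis by linarith+
    have "u\<^sup>2 * (c / 16) \<le> u\<^sup>2 * (c / 2 / 2)" using c(1) by (intro mult_left_mono) auto
    with *(1) have "\<bar>?\<Delta> - u\<^sup>2 * G i i z0\<bar> \<le> u\<^sup>2 * (c / 2 / 2)" by linarith
    moreover have "P * u\<^sup>2 \<le> 4 * P * u\<^sup>2" using P0 by (intro mult_right_mono) auto
    with *(2) have "\<bar>?\<Delta>\<bar> \<le> 4 * P * u\<^sup>2" by linarith
    ultimately have "c / 2 / 2 * u\<^sup>2 \<le> (if G i i z0 \<ge> 0 then 1 else -1) * ?\<Delta> \<and>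
        (if G i i z0 \<ge> 0 then 1 else -1) * ?\<Delta> \<le> 4 * P * u\<^sup>2"
      by (rule sign_second_difference[OF i])
    moreover have "c / 2 / 2 = c / 4" by simp
    ultimately show "c / 4 * u\<^sup>2 \<le> (if G i i z0 \<ge> 0 then 1 else -1) * ?\<Delta> \<and>
        (if G i i z0 \<ge> 0 then 1 else -1) * ?\<Delta> \<le> 4 * P * u\<^sup>2" by (simp only:)
  qed (auto simp: axis_def)
  show thesis
  proof (cases "k = l \<or> \<bar>G k k z0\<bar> \<ge> c / 2 \<or> \<bar>G l l z0\<bar> \<ge> c / 2")
    case True
    then show thesis using pure[of k] pure[of l] c by auto
  next
    case False
    define W where "W = 2 * G k l z0 + G k k z0 + G l l z0"
    have W: "\<bar>W\<bar> \<ge> c" using False c unfolding W_def by linarith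
    let ?v = "axis k 1 + axis l 1 :: int^'d"
    show thesis
    proof (rule direction[of ?v k "if W \<ge> 0 then 1 else -1"])
      fix x :: "real^'d" and u :: real assume xu: "u \<ge> 0" "x \<in> B" "x + (2 * u) *\<^sub>R of_int_vec ?v \<in> B"
      let ?p = "\<lambda>\<alpha> \<beta>. x + \<alpha> *\<^sub>R axis k 1 + \<beta> *\<^sub>R axis l 1"
      let ?F = "\<lambda>\<alpha> \<beta>. h \<bullet> f (?p \<alpha> \<beta>)"
      have mem: "?p \<alpha> \<beta> \<in> B" if "\<alpha> \<in> {0..2 * u}" "\<beta> \<in> {0..2 * u}" for \<alpha> \<beta>
        using conv[OF xu(2,3)] that False
        by (auto simp: subset_iff mem_box_cart axis_def)
      have step: "?p \<alpha> \<beta> + u *\<^sub>R axis k 1 = ?p (\<alpha> + u) \<beta>" "?p \<alpha> \<beta> + u *\<^sub>R axis l 1 = ?p \<alpha> (\<beta> + u)" for \<alpha> \<beta>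
        by (simp_all add: algebra_simps)
      have m: "?p \<alpha> \<beta> \<in> B" if "\<alpha> \<in> {0, u, 2 * u}" "\<beta> \<in> {0, u, 2 * u}" for \<alpha> \<beta>
        using that xu(1) by (intro mem) auto
      \<comment> \<open>In the square of side 2u the diagonal second difference is the sum of four
        pieces: the mixed differences over the lower left and upper right subsquares, and the second
        differences along k and along l through the centre. All other values cancel. Both mixed
        pieces are taken in the same order of differentiation, so both are compared with G k
        l.\<close>
      have M00: "\<bar>?F u u - ?F u 0 - ?F 0 u + ?F 0 0 - u\<^sup>2 * G k l z0\<bar> \<le> u\<^sup>2 * (c / 16) \<and>
          \<bar>?F u u - ?F u 0 - ?F 0 u + ?F 0 0\<bar> \<le> P * u\<^sup>2"
        using approx[OF xu(1) m[of 0 0], of k l] m[of u u] unfolding step by simp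
      have M11: "\<bar>?F (2*u) (2*u) - ?F (2*u) u - ?F u (2*u) + ?F u u - u\<^sup>2 * G k l z0\<bar> \<le> u\<^sup>2 * (c / 16) \<and>
          \<bar>?F (2*u) (2*u) - ?F (2*u) u - ?F u (2*u) + ?F u u\<bar> \<le> P * u\<^sup>2"
        using approx[OF xu(1) m[of u u], of k l] m[of "2*u" "2*u"] unfolding step by (simp flip: mult_2)
      have Dk: "\<bar>?F (2*u) u - ?F u u - ?F u u + ?F 0 u - u\<^sup>2 * G k k z0\<bar> \<le> u\<^sup>2 * (c / 16) \<and>
          \<bar>?F (2*u) u - ?F u u - ?F u u + ?F 0 u\<bar> \<le> P * u\<^sup>2"
        using approx[OF xu(1) m[of 0 u], of k k] m[of "2*u" u] unfolding step by (simp flip: mult_2)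
      have Dl: "\<bar>?F u (2*u) - ?F u u - ?F u u + ?F u 0 - u\<^sup>2 * G l l z0\<bar> \<le> u\<^sup>2 * (c / 16) \<and>
          \<bar>?F u (2*u) - ?F u u - ?F u u + ?F u 0\<bar> \<le> P * u\<^sup>2"
        using approx[OF xu(1) m[of u 0], of l l] m[of u "2*u"] unfolding step by (simp flip: mult_2)
      let ?\<Delta> = "?F (2*u) (2*u) - 2 * ?F u u + ?F 0 0"
      have eq: "u\<^sup>2 * W = u\<^sup>2 * G k l z0 + u\<^sup>2 * G k l z0 + u\<^sup>2 * G k k z0 + u\<^sup>2 * G l l z0"
        by (simp add: W_def algebra_simps)
      have "\<bar>?\<Delta> - u\<^sup>2 * W\<bar> \<le> 4 * (u\<^sup>2 * (c / 16))"
        using abs_sum_four_le[OF M00[THEN conjunct1] M11[THEN conjunct1] Dk[THEN conjunct1] Dl[THEN conjunct1]]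
        unfolding eq by (simp add: algebra_simps)
      moreover have "\<bar>?\<Delta>\<bar> \<le> 4 * (P * u\<^sup>2)"
        using abs_sum_four_le[OF M00[THEN conjunct2] M11[THEN conjunct2] Dk[THEN conjunct2] Dl[THEN conjunct2]]
        by (simp add: algebra_simps)
      moreover have "4 * (u\<^sup>2 * (c / 16)) \<le> u\<^sup>2 * (c / 2)" using c(1) by simp
      ultimately have *: "c / 2 * u\<^sup>2 \<le> (if W \<ge> 0 then 1 else -1) * ?\<Delta> \<and> (if W \<ge> 0 then 1 else -1) * ?\<Delta> \<le> (4 * P) * u\<^sup>2"
        by (intro sign_second_difference[OF W]) linarith+
      have "c / 4 * u\<^sup>2 \<le> c / 2 * u\<^sup>2" using c(1) by (intro mult_right_mono) auto
      with * have "c / 4 * u\<^sup>2 \<le> (if W \<ge> 0 then 1 else -1) * ?\<Delta> \<and> (if W \<ge> 0 then 1 else -1) * ?\<Delta> \<le> (4 * P) * u\<^sup>2"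
        by linarith
      moreover have "?p (2*u) (2*u) = x + (2 * u) *\<^sub>R of_int_vec ?v" "?p u u = x + u *\<^sub>R of_int_vec ?v" "?p 0 0 = x"
        by (simp_all add: of_int_vec_add of_int_vec_axis scaleR_right_distrib)
      ultimately show "c / 4 * u\<^sup>2 \<le> (if W \<ge> 0 then 1 else -1) * (h \<bullet> f (x + (2 * u) *\<^sub>R of_int_vec ?v)
            - 2 * (h \<bullet> f (x + u *\<^sub>R of_int_vec ?v)) + h \<bullet> f x) \<and>
          (if W \<ge> 0 then 1 else -1) * (h \<bullet> f (x + (2 * u) *\<^sub>R of_int_vec ?v)
            - 2 * (h \<bullet> f (x + u *\<^sub>R of_int_vec ?v)) + h \<bullet> f x) \<le> 4 * P * u\<^sup>2"
        by (simp only:)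
    qed (use False in \<open>auto simp: axis_def\<close>)
  qed
qed

text \<open>The norm of A \<alpha> h attains a positive minimum on the product of K with the unit
  sphere, and homogeneity extends the bound to all h. In the application, entry i of the product is
  a mixed second derivative of h.f, so some such derivative is of size |h| at every point.\<close>

lemma matrix_family_lower_bound:
  fixes A :: "'a::topological_space \<Rightarrow> real^'m^'m"
  assumes K: "compact K" "K \<noteq> {}" and cont: "\<And>i j. continuous_on K (\<lambda>\<alpha>. A \<alpha> $ i $ j)"
    and det: "\<And>\<alpha>. \<alpha> \<in> K \<Longrightarrow> det (A \<alpha>) \<noteq> 0"
  obtains c where "c > 0" "\<And>\<alpha> h. \<alpha> \<in> K \<Longrightarrow> \<exists>i. \<bar>(A \<alpha> *v h) $ i\<bar> \<ge> c * norm h"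
proof -
  let ?S = "sphere (0::real^'m) 1"
  let ?g = "\<lambda>z. norm (A (fst z) *v snd z)"
  have cA: "continuous_on (K \<times> ?S) (\<lambda>z. A (fst z) $ i $ j)" for i j
    by (rule continuous_on_compose2[OF cont continuous_on_fst[OF continuous_on_id]]) auto
  have "continuous_on (K \<times> ?S) ?g"
    unfolding matrix_vector_mult_def
    by (intro continuous_on_norm continuous_on_vec_lambda continuous_on_sum continuous_on_mult cA
        continuous_on_component[OF continuous_on_snd] continuous_on_id)
  moreover have "axis undefined 1 \<in> ?S" by simp
  then have "K \<times> ?S \<noteq> {}" using K(2) by blast
  moreover have "compact (K \<times> ?S)" using K(1) by (intro compact_Times) auto
  ultimately have "\<exists>z\<in>K \<times> ?S. \<forall>y\<in>K \<times> ?S. ?g z \<le> ?g y"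
    by (intro continuous_attains_inf)
  then obtain z where z: "z \<in> K \<times> ?S" "\<And>y. y \<in> K \<times> ?S \<Longrightarrow> ?g z \<le> ?g y" by blast
  have "?g z > 0"
  proof -
    have "invertible (A (fst z))" using det[of "fst z"] z(1) by (auto simp: invertible_det_nz)
    then have "A (fst z) *v snd z \<noteq> 0"
      using z(1) by (metis invertible_def matrix_left_invertible_ker mem_Times_iff norm_zero mem_sphere_0 zero_neq_one)
    then show ?thesis by simp
  qed
  \<comment> \<open>Some coordinate has at least the average size, the norm divided by the
    dimension; the extra factor 2 makes the contradiction below strict.\<close>
  define c where "c = ?g z / (2 * CARD('m))"
  show thesis
  proof (rule that)
    show "c > 0" using \<open>?g z > 0\<close> by (simp add: c_def)
    fix \<alpha> h assume \<alpha>: "\<alpha> \<in> K"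
    show "\<exists>i. \<bar>(A \<alpha> *v h) $ i\<bar> \<ge> c * norm h"
    proof (cases "h = 0")
      case False
      have "(\<alpha>, (1 / norm h) *\<^sub>R h) \<in> K \<times> ?S" using \<alpha> False by simp
      from z(2)[OF this] have "?g z * norm h \<le> norm (A \<alpha> *v h)"
        using False by (simp add: matrix_vector_mult_scaleR field_simps)
      moreover have "norm (A \<alpha> *v h) \<le> (\<Sum>i\<in>UNIV. \<bar>(A \<alpha> *v h) $ i\<bar>)" by (rule norm_le_l1_cart)
      ultimately have 1: "?g z * norm h \<le> (\<Sum>i\<in>UNIV. \<bar>(A \<alpha> *v h) $ i\<bar>)" by linarith
      show ?thesis
      proof (rule ccontr)
        assume "\<not> ?thesis"
        then have "(\<Sum>i\<in>UNIV. \<bar>(A \<alpha> *v h) $ i\<bar>) \<le> (\<Sum>i\<in>(UNIV::'m set). c * norm h)"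
          by (intro sum_mono) (auto simp: not_le less_imp_le)
        also have "\<dots> = ?g z * norm h / 2" by (simp add: c_def)
        finally have "(\<Sum>i\<in>UNIV. \<bar>(A \<alpha> *v h) $ i\<bar>) \<le> ?g z * norm h / 2" .
        moreover have "?g z * norm h > 0" using \<open>?g z > 0\<close> False by (intro mult_pos_pos) auto
        ultimately show False using 1 by linarith
      qed
    qed simp
  qed
qed

section \<open>The exponential sum over the cube\<close>

lemma norm_int_vec_ge_1:
  assumes "h \<noteq> 0"
  shows "norm (of_int_vec h) \<ge> 1"
proof -
  obtain j where "h $ j \<noteq> 0" using assms by (auto simp: vec_eq_iff)
  then have "\<bar>h $ j\<bar> \<ge> 1" by linarith
  then have "\<bar>of_int_vec h $ j\<bar> \<ge> 1" by (simp del: of_int_abs add: of_int_abs[symmetric])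
  then show ?thesis using component_le_norm_cart[of "of_int_vec h" j] by linarith
qed

lemma C2_second_partials_bounded:
  fixes f :: "real^'d \<Rightarrow> 'b::real_normed_vector"
  assumes "C2_partials_on unit_cube f"
  obtains P where "P \<ge> 0"
    "\<And>i j x. x \<in> unit_cube \<Longrightarrow> norm (partial_deriv unit_cube i (partial_deriv unit_cube j f) x) \<le> P"
proof -
  let ?D = "\<lambda>z. partial_deriv unit_cube (fst z) (partial_deriv unit_cube (snd z) f)"
  have "bounded (?D z ` unit_cube)" for z
    using assms by (intro compact_imp_bounded compact_continuous_image) (auto simp: C2_partials_on_def)
  then have "bounded (\<Union>z. ?D z ` unit_cube)" by (intro bounded_UN) auto
  then obtain P where "\<And>y. y \<in> (\<Union>z. ?D z ` unit_cube) \<Longrightarrow> norm y \<le> P" by (auto simp: bounded_iff)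
  then have "norm (partial_deriv unit_cube i (partial_deriv unit_cube j f) x) \<le> \<bar>P\<bar>" if "x \<in> unit_cube" for i j x
    using that by (fastforce intro: order_trans[OF _ abs_ge_self])
  then show thesis by (intro that[of "\<bar>P\<bar>"]) auto
qed

lemma C2_second_partials_uniformly_continuous:
  fixes f :: "real^'d \<Rightarrow> 'b::real_normed_vector"
  assumes "C2_partials_on unit_cube f" "\<epsilon> > 0"
  obtains \<delta> where "\<delta> > 0"
    "\<And>i j x y. x \<in> unit_cube \<Longrightarrow> y \<in> unit_cube \<Longrightarrow> dist x y < \<delta> \<Longrightarrow>
      dist (partial_deriv unit_cube i (partial_deriv unit_cube j f) x)
        (partial_deriv unit_cube i (partial_deriv unit_cube j f) y) < \<epsilon>"
proof -
  let ?D = "\<lambda>z. partial_deriv unit_cube (fst z) (partial_deriv unit_cube (snd z) f)"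
  have "uniformly_continuous_on unit_cube (?D z)" for z
    using assms(1) by (intro compact_uniformly_continuous) (auto simp: C2_partials_on_def)
  then have "\<forall>z. \<exists>d>0. \<forall>x\<in>unit_cube. \<forall>y\<in>unit_cube. dist x y < d \<longrightarrow> dist (?D z x) (?D z y) < \<epsilon>"
    using assms(2) unfolding uniformly_continuous_on_def by (metis dist_commute)
  then obtain d where d: "\<And>z. d z > 0"
    "\<And>z x y. x \<in> unit_cube \<Longrightarrow> y \<in> unit_cube \<Longrightarrow> dist x y < d z \<Longrightarrow> dist (?D z x) (?D z y) < \<epsilon>"
    by metis
  show thesis
  proof (rule that[of "Min (range d)"])
    show "Min (range d) > 0" using d(1) by (subst Min_gr_iff) auto
    fix i j and x y :: "real^'d" assume xy: "x \<in> unit_cube" "y \<in> unit_cube" "dist x y < Min (range d)"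
    have "Min (range d) \<le> d (i, j)" by (intro Min_le) auto
    with xy d(2)[of x y "(i, j)"]
    show "dist (partial_deriv unit_cube i (partial_deriv unit_cube j f) x)
        (partial_deriv unit_cube i (partial_deriv unit_cube j f) y) < \<epsilon>" by simp
  qed
qed

text \<open>On one cell the second differences have size comparable to |h|, so a line costs a
  multiple of |h| times sqrt (q / |h|) + 1. This explains both terms of the bound; the second
  matters only when |h| exceeds q.\<close>

lemma exponential_sum_bound:
  fixes f :: "real^'d \<Rightarrow> real^'m" and k :: 'd and \<iota> :: "'m \<Rightarrow> 'd"
  assumes C2: "C2_partials_on unit_cube f"
    and det: "\<And>\<alpha>. \<alpha> \<in> unit_cube \<Longrightarrow>
      det ((\<chi> i j. partial_deriv unit_cube k (partial_deriv unit_cube (\<iota> i) f) \<alpha> $ j) :: real^'m^'m) \<noteq> 0"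
  obtains C where "C \<ge> 0"
    "\<And>(l :: real^'d) (q :: nat) (h :: int^'m). q \<ge> 1 \<Longrightarrow> h \<noteq> 0 \<Longrightarrow>
      norm (\<Sum>a | shifted_point q l a \<in> unit_cube. ee (real q * (of_int_vec h \<bullet> f (shifted_point q l a))))
        \<le> C * real q ^ (CARD('d) - 1) * (sqrt (real q * norm (of_int_vec h)) + norm (of_int_vec h))"
proof -
  let ?U = "unit_cube :: (real^'d) set"
  let ?D = "\<lambda>i j. partial_deriv ?U i (partial_deriv ?U j f)"
  let ?A = "\<lambda>\<alpha>. (\<chi> i j. ?D k (\<iota> i) \<alpha> $ j) :: real^'m^'m"
  have "continuous_on ?U (\<lambda>\<alpha>. ?A \<alpha> $ i $ j)" for i j
    using C2 by (auto simp: C2_partials_on_def intro!: continuous_on_component)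
  moreover have "0 \<in> ?U" by (simp add: mem_box_cart)
  then have "?U \<noteq> {}" by blast
  ultimately obtain c where c: "c > 0" "\<And>\<alpha> h. \<alpha> \<in> ?U \<Longrightarrow> \<exists>i. \<bar>(?A \<alpha> *v h) $ i\<bar> \<ge> c * norm h"
    using matrix_family_lower_bound[of ?U ?A] det by (metis compact_cbox)
  obtain P where P: "P \<ge> 0" "\<And>i j x. x \<in> ?U \<Longrightarrow> norm (?D i j x) \<le> P"
    using C2_second_partials_bounded[OF C2] by metis
  obtain \<delta> where \<delta>: "\<delta> > 0" "\<And>i j x y. x \<in> ?U \<Longrightarrow> y \<in> ?U \<Longrightarrow> dist x y < \<delta> \<Longrightarrow> dist (?D i j x) (?D i j y) < c / 16"
    using C2_second_partials_uniformly_continuous[OF C2, of "c / 16"] c(1) by auto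
  \<comment> \<open>Points of a cell differ by at most 1 / K in each coordinate, so their distance
    is at most d / K < \<delta>.\<close>
  obtain K where K: "real CARD('d) / \<delta> < real K" using reals_Archimedean2 by blast
  then have K0: "K > 0" using \<delta>(1) by (metis divide_nonneg_pos gr0I of_nat_0 of_nat_0_le_iff not_le)
  \<comment> \<open>Cells as fibres of a floor map partition the cube, so each lattice point is
    counted once, and monotonicity of the floor makes them closed under boxes.\<close>
  define cell where "cell x = (\<chi> i. \<lfloor>real K * x $ i\<rfloor>)" for x :: "real^'d"
  define B where "B \<kappa> = {x \<in> ?U. cell x = \<kappa>}" for \<kappa> :: "int^'d"
  \<comment> \<open>The index K occurs: the points with a coordinate equal to 1 form degenerate
    cells of their own.\<close>
  define cells where "cells = {\<kappa>::int^'d. \<forall>i. \<kappa> $ i \<in> {0..int K}}"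
  have fin: "finite cells" unfolding cells_def by (rule finite_int_vec_box) simp
  have BU: "B \<kappa> \<subseteq> ?U" for \<kappa> by (auto simp: B_def)
  have floor_cell: "\<lfloor>real K * x $ i\<rfloor> = \<kappa> $ i" if "x \<in> B \<kappa>" for x \<kappa> i
  proof -
    have "\<kappa> = cell x" using that by (simp add: B_def)
    then show ?thesis by (simp add: cell_def)
  qed
  have conv: "cbox x y \<subseteq> B \<kappa>" if "x \<in> B \<kappa>" "y \<in> B \<kappa>" for x y \<kappa>
  proof
    fix z assume z: "z \<in> cbox x y"
    have "\<lfloor>real K * z $ i\<rfloor> = \<kappa> $ i" for i
    proof -
      have "x $ i \<le> z $ i" "z $ i \<le> y $ i" using z by (auto simp: mem_box_cart)
      then have "\<lfloor>real K * x $ i\<rfloor> \<le> \<lfloor>real K * z $ i\<rfloor>" "\<lfloor>real K * z $ i\<rfloor> \<le> \<lfloor>real K * y $ i\<rfloor>"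
        by (auto intro!: floor_mono mult_left_mono)
      moreover have "\<lfloor>real K * x $ i\<rfloor> = \<kappa> $ i" "\<lfloor>real K * y $ i\<rfloor> = \<kappa> $ i"
        using that by (simp_all add: floor_cell)
      ultimately show ?thesis by linarith
    qed
    moreover have "z \<in> ?U"
      using z that unfolding B_def by (auto simp: mem_box_cart intro: order_trans)
    ultimately show "z \<in> B \<kappa>" by (simp add: B_def cell_def vec_eq_iff)
  qed
  have close: "dist x y < \<delta>" if "x \<in> B \<kappa>" "y \<in> B \<kappa>" for x y \<kappa>
  proof -
    have "\<bar>(x - y) $ i\<bar> \<le> 1 / K" for i
    proof -
      have "\<lfloor>real K * x $ i\<rfloor> = \<kappa> $ i" "\<lfloor>real K * y $ i\<rfloor> = \<kappa> $ i"
        using that by (simp_all add: floor_cell)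
      then have "\<bar>real K * x $ i - real K * y $ i\<bar> \<le> 1" by linarith
      then have "real K * \<bar>x $ i - y $ i\<bar> \<le> 1" by (simp add: abs_mult flip: right_diff_distrib)
      then show ?thesis using K0 by (simp add: field_simps)
    qed
    then have "(\<Sum>i\<in>UNIV. \<bar>(x - y) $ i\<bar>) \<le> (\<Sum>i\<in>(UNIV::'d set). 1 / K)" by (intro sum_mono)
    also have "\<dots> = real CARD('d) / K" by simp
    also have "\<dots> < \<delta>" using K K0 \<delta>(1) by (simp add: field_simps)
    finally show ?thesis using norm_le_l1_cart[of "x - y"] by (simp add: dist_norm)
  qed
  \<comment> \<open>The power of 3 counts the lines. Since \<mu> = c |h| / 4 and M = 4 P |h|, the
    factor 8 / sqrt c is 4 * sqrt (4 / c), and 8 P comes from 2 M.\<close>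
  define C0 where "C0 = 3 ^ (CARD('d) - 1) * ((8 * P + 2) * (8 / sqrt c + 3))"
  have C0: "C0 \<ge> 0" using P(1) c(1) by (simp add: C0_def)
  have cellsum: "norm (\<Sum>a | shifted_point q l a \<in> B \<kappa>. ee (real q * (of_int_vec h \<bullet> f (shifted_point q l a))))
        \<le> C0 * real q ^ (CARD('d) - 1) * (sqrt (real q * norm (of_int_vec h)) + norm (of_int_vec h))"
    if q: "q \<ge> 1" and h: "h \<noteq> 0" for l q h \<kappa>
  proof (cases "B \<kappa> = {}")
    case True
    then show ?thesis using C0 by simp
  next
    case False
    then obtain z0 where z0: "z0 \<in> B \<kappa>" by blast
    let ?h = "of_int_vec h :: real^'m"
    have nh: "norm ?h \<ge> 1" by (rule norm_int_vec_ge_1[OF h])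
    obtain i where i: "\<bar>(?A z0 *v ?h) $ i\<bar> \<ge> c * norm ?h" using c(2) z0 BU by blast
    have "(?A z0 *v ?h) $ i = ?h \<bullet> ?D k (\<iota> i) z0"
      by (simp add: matrix_vector_mult_def inner_vec_def mult.commute)
    with i have i': "\<bar>?h \<bullet> ?D k (\<iota> i) z0\<bar> \<ge> c * norm ?h" by simp
    have ch: "c * norm ?h > 0" using c(1) nh by (intro mult_pos_pos) auto
    have osc: "\<bar>?h \<bullet> ?D i j x - ?h \<bullet> ?D i j z0\<bar> \<le> c * norm ?h / 16" if "x \<in> B \<kappa>" for i j x
    proof -
      have "norm (?D i j x - ?D i j z0) \<le> c / 16"
        using \<delta>(2)[of x z0 i j] close[OF that z0] that z0 BU[of \<kappa>] by (auto simp: dist_norm subset_iff intro: less_imp_le)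
      then have "norm ?h * norm (?D i j x - ?D i j z0) \<le> norm ?h * (c / 16)" by (rule mult_left_mono) simp
      moreover have "\<bar>?h \<bullet> (?D i j x - ?D i j z0)\<bar> \<le> norm ?h * norm (?D i j x - ?D i j z0)"
        by (rule Cauchy_Schwarz_ineq2)
      ultimately have "\<bar>?h \<bullet> (?D i j x - ?D i j z0)\<bar> \<le> norm ?h * (c / 16)" by linarith
      then show ?thesis by (simp add: inner_diff_right mult.commute)
    qed
    have bd: "\<bar>?h \<bullet> ?D i j x\<bar> \<le> P * norm ?h" if "x \<in> B \<kappa>" for i j x
    proof -
      have "\<bar>?h \<bullet> ?D i j x\<bar> \<le> norm ?h * norm (?D i j x)" by (rule Cauchy_Schwarz_ineq2)
      also have "\<dots> \<le> norm ?h * P" using P(2)[of x i j] that BU[of \<kappa>] by (intro mult_left_mono) auto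
      finally show ?thesis by (simp add: mult.commute)
    qed
    obtain v :: "int^'d" and p s where v: "v $ p = 1" "\<And>i. v $ i \<in> {0, 1}" "\<bar>s::real\<bar> = 1"
      "\<And>x u. u \<ge> 0 \<Longrightarrow> x \<in> B \<kappa> \<Longrightarrow> x + (2 * u) *\<^sub>R of_int_vec v \<in> B \<kappa> \<Longrightarrow>
        c * norm ?h / 4 * u\<^sup>2 \<le> s * (?h \<bullet> f (x + (2 * u) *\<^sub>R of_int_vec v) - 2 * (?h \<bullet> f (x + u *\<^sub>R of_int_vec v)) + ?h \<bullet> f x) \<and>
        s * (?h \<bullet> f (x + (2 * u) *\<^sub>R of_int_vec v) - 2 * (?h \<bullet> f (x + u *\<^sub>R of_int_vec v)) + ?h \<bullet> f x) \<le> 4 * (P * norm ?h) * u\<^sup>2"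
      by (rule exists_curved_direction[OF C2 BU conv z0 ch i' osc bd]) blast+
    have "norm (\<Sum>a | shifted_point q l a \<in> B \<kappa>. ee (real q * (?h \<bullet> f (shifted_point q l a))))
        \<le> (3 * real q) ^ (CARD('d) - 1) * ((2 * (4 * (P * norm ?h)) + 2) * (4 * sqrt (real q / (c * norm ?h / 4)) + 3))"
      by (rule exp_sum_cell[where F = "\<lambda>x. ?h \<bullet> f x", OF q BU conv v(1,2) _ _ v(3) v(4)])
        (use ch P(1) in auto)
    also have "\<dots> \<le> (3 * real q) ^ (CARD('d) - 1) *
        ((8 * P + 2) * (8 / sqrt c + 3) * (sqrt (real q * norm ?h) + norm ?h))"
    proof (intro mult_left_mono)
      define n where "n = norm ?h"
      have n: "n \<ge> 1" "sqrt n > 0" "n = sqrt n * sqrt n" using nh by (auto simp: n_def)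
      have sq: "4 * sqrt (real q / (c * n / 4)) = 8 / sqrt c * (sqrt q / sqrt n)"
        by (simp add: real_sqrt_divide real_sqrt_mult)
      have r: "0 \<le> 8 / sqrt c" using c(1) by simp
      have nq: "n * (sqrt q / sqrt n) = sqrt (real q * n)"
      proof -
        have "n * (sqrt q / sqrt n) = sqrt n * sqrt q"
          using n(2) by (subst n(3)) (simp add: field_simps)
        then show ?thesis by (simp add: real_sqrt_mult)
      qed
      \<comment> \<open>As n >= 1, the summand 2 is absorbed into a multiple of n. Multiplying n by
        the second factor then produces sqrt (q n) and n.\<close>
      have "2 * (4 * (P * n)) + 2 \<le> (8 * P + 2) * n" using n(1) by (simp add: algebra_simps)
      then have "(2 * (4 * (P * n)) + 2) * (4 * sqrt (real q / (c * n / 4)) + 3)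
          \<le> (8 * P + 2) * n * (8 / sqrt c * (sqrt q / sqrt n) + 3)"
        unfolding sq using r n by (intro mult_right_mono) auto
      also have "\<dots> = (8 * P + 2) * (8 / sqrt c * (n * (sqrt q / sqrt n)) + 3 * n)"
        by (simp add: algebra_simps)
      also have "\<dots> \<le> (8 * P + 2) * ((8 / sqrt c + 3) * (sqrt (real q * n) + n))"
      proof (rule mult_left_mono)
        have "0 \<le> 8 / sqrt c * n" "0 \<le> sqrt (real q * n)" using r n(1) by (auto intro!: mult_nonneg_nonneg)
        then show "8 / sqrt c * (n * (sqrt q / sqrt n)) + 3 * n \<le> (8 / sqrt c + 3) * (sqrt (real q * n) + n)"
          unfolding nq distrib_left distrib_right by linarith
      qed (use P(1) in auto)
      finally show "(2 * (4 * (P * norm ?h)) + 2) * (4 * sqrt (real q / (c * norm ?h / 4)) + 3)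
          \<le> (8 * P + 2) * (8 / sqrt c + 3) * (sqrt (real q * norm ?h) + norm ?h)"
        by (simp add: n_def mult.assoc)
    qed simp
    also have "\<dots> = C0 * real q ^ (CARD('d) - 1) * (sqrt (real q * norm ?h) + norm ?h)"
      by (simp add: C0_def power_mult_distrib mult_ac)
    finally show ?thesis .
  qed
  show thesis
  proof (rule that[of "real (card cells) * C0"])
    show "real (card cells) * C0 \<ge> 0" using C0 by simp
    fix l :: "real^'d" and q :: nat and h :: "int^'m" assume q: "q \<ge> 1" and h: "h \<noteq> 0"
    let ?S = "{a. shifted_point q l a \<in> ?U}"
    let ?e = "\<lambda>a. ee (real q * (of_int_vec h \<bullet> f (shifted_point q l a)))"
    have "(\<lambda>a. cell (shifted_point q l a)) ` ?S \<subseteq> cells"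
    proof (intro image_subsetI)
      fix a assume "a \<in> ?S"
      then have x: "0 \<le> shifted_point q l a $ i" "shifted_point q l a $ i \<le> 1" for i
        by (auto simp: mem_box_cart)
      have "0 \<le> \<lfloor>real K * shifted_point q l a $ i\<rfloor> \<and> \<lfloor>real K * shifted_point q l a $ i\<rfloor> \<le> int K" for i
        using mult_left_mono[OF x(2), of "real K" i] x(1)[of i] by (simp add: floor_le_iff)
      then show "cell (shifted_point q l a) \<in> cells" by (simp add: cells_def cell_def)
    qed
    then have "(\<Sum>a\<in>?S. ?e a) = (\<Sum>\<kappa>\<in>cells. \<Sum>a\<in>{a\<in>?S. cell (shifted_point q l a) = \<kappa>}. ?e a)"
      by (intro sum.group[symmetric] fin finite_shifted_points(1)[OF q])
    also have "\<dots> = (\<Sum>\<kappa>\<in>cells. \<Sum>a | shifted_point q l a \<in> B \<kappa>. ?e a)"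
      by (simp add: B_def)
    also have "norm \<dots> \<le> (\<Sum>\<kappa>\<in>cells. C0 * real q ^ (CARD('d) - 1) * (sqrt (real q * norm (of_int_vec h)) + norm (of_int_vec h)))"
      by (intro sum_norm_le cellsum q h)
    finally show "norm (\<Sum>a\<in>?S. ?e a) \<le>
        real (card cells) * C0 * real q ^ (CARD('d) - 1) * (sqrt (real q * norm (of_int_vec h)) + norm (of_int_vec h))"
      by (simp add: mult.assoc)
  qed
qed

section \<open>Counting points close to integer vectors\<close>

lemma Re_ee_ge_half:
  assumes "\<bar>t\<bar> \<le> 1 / 6"
  shows "Re (ee t) \<ge> 1 / 2"
proof -
  have "pi * \<bar>t\<bar> \<le> pi * (1 / 6)" using assms by (intro mult_left_mono) auto
  then have "2 * pi * \<bar>t\<bar> \<le> pi / 3" by simp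
  then have "cos (pi / 3) \<le> cos (2 * pi * \<bar>t\<bar>)" by (intro cos_monotone_0_pi_le) auto
  then show ?thesis by (cases "t \<ge> 0") (auto simp: ee_def cos_60)
qed

text \<open>The squared modulus of \<open>F\<close> is a product of Fejer kernels up to
  normalization: nonnegative everywhere, and at least |K|^2 / 4 near integer vectors because each
  term of \<open>F\<close> has real part at least 1/2 there. Expanding the square and summing over
  S, the diagonal contributes |K| |S| and every pair of frequencies at most E. Division by |K|^2 / 4
  gives the claim.\<close>

lemma count_near_integers_le:
  fixes y :: "'a \<Rightarrow> real^'m" and H :: nat
  assumes S: "finite S" and H: "H \<ge> 1" "real CARD('m) * (real H - 1) * p \<le> 1 / 6"
    and E: "E \<ge> 0" "\<And>h. h \<noteq> 0 \<Longrightarrow> (\<And>j. \<bar>h $ j\<bar> < int H) \<Longrightarrow> norm (\<Sum>a\<in>S. ee (of_int_vec h \<bullet> y a)) \<le> E"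
  shows "real (card {a\<in>S. \<exists>b. infnorm (y a - of_int_vec b) < p}) \<le> 4 * (real (card S) / real H ^ CARD('m) + E)"
proof -
  define K where "K = {k::int^'m. \<forall>j. k $ j \<in> {0..<int H}}"
  have fK: "finite K" unfolding K_def by (rule finite_int_vec_box) simp
  have cK: "card K = H ^ CARD('m)" unfolding K_def card_int_vec_box by simp
  have cK0: "real (card K) > 0" using H(1) cK by simp
  define A where "A = {a\<in>S. \<exists>b. infnorm (y a - of_int_vec b) < p}"
  define F where "F a = (\<Sum>k\<in>K. ee (of_int_vec k \<bullet> y a))" for a
  have lower: "real (card K) / 2 \<le> norm (F a)" if "a \<in> A" for a
  proof -
    obtain b where b: "infnorm (y a - of_int_vec b) < p" using \<open>a \<in> A\<close> by (auto simp: A_def)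
    have "Re (ee (of_int_vec k \<bullet> y a)) \<ge> 1 / 2" if k: "k \<in> K" for k
    proof -
      let ?z = "y a - of_int_vec b"
      \<comment> \<open>Replacing \<open>y a\<close> by its displacement from b changes the phase by
        an integer, which \<open>ee\<close> does not see.\<close>
      have "of_int_vec k \<bullet> y a = of_int_vec k \<bullet> ?z + of_int (\<Sum>j\<in>UNIV. k $ j * b $ j)"
        unfolding inner_diff_right by (simp add: inner_vec_def)
      then have "ee (of_int_vec k \<bullet> y a) = ee (of_int_vec k \<bullet> ?z)" by (simp only: ee_add_int)
      moreover have "\<bar>of_int_vec k \<bullet> ?z\<bar> \<le> 1 / 6"
      proof -
        have "\<bar>of_int_vec k \<bullet> ?z\<bar> \<le> (\<Sum>j\<in>UNIV. \<bar>of_int_vec k $ j \<bullet> ?z $ j\<bar>)"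
          unfolding inner_vec_def by (rule sum_abs)
        also have "\<dots> \<le> (\<Sum>j\<in>(UNIV::'m set). (real H - 1) * p)"
        proof (rule sum_mono)
          fix j
          have "0 \<le> k $ j" "k $ j \<le> int H - 1" using k by (auto simp: K_def)
          then have "\<bar>of_int_vec k $ j\<bar> \<le> real H - 1" by simp
          moreover have "\<bar>?z $ j\<bar> \<le> p" using component_le_infnorm_cart[of ?z j] b by linarith
          ultimately show "\<bar>of_int_vec k $ j \<bullet> ?z $ j\<bar> \<le> (real H - 1) * p"
            unfolding inner_real_def abs_mult by (intro mult_mono) auto
        qed
        also have "\<dots> \<le> 1 / 6" using H(2) by (simp add: mult.assoc)
        finally show ?thesis .
      qed
      ultimately show ?thesis using Re_ee_ge_half by simp
    qed
    then have "(\<Sum>k\<in>K. 1 / 2) \<le> Re (F a)" unfolding F_def Re_sum by (rule sum_mono)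
    then show ?thesis using complex_Re_le_cmod[of "F a"] by simp
  qed
  have "real (card K) ^ 2 / 4 * real (card A) = (\<Sum>a\<in>A. (real (card K) / 2)\<^sup>2)"
    by (simp add: power2_eq_square)
  also have "\<dots> \<le> (\<Sum>a\<in>A. (norm (F a))\<^sup>2)" by (intro sum_mono power_mono lower) auto
  also have "\<dots> \<le> (\<Sum>a\<in>S. (norm (F a))\<^sup>2)" using S by (intro sum_mono2) (auto simp: A_def)
  also have "\<dots> \<le> norm (\<Sum>a\<in>S. complex_of_real ((norm (F a))\<^sup>2))"
    by (metis abs_ge_self norm_of_real of_real_sum)
  also have "(\<Sum>a\<in>S. complex_of_real ((norm (F a))\<^sup>2))
      = (\<Sum>a\<in>S. \<Sum>k\<in>K. \<Sum>k'\<in>K. ee (of_int_vec (k - k') \<bullet> y a))"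
  proof (rule sum.cong[OF refl])
    fix a
    have "complex_of_real ((norm (F a))\<^sup>2) = F a * cnj (F a)" by (rule complex_norm_square)
    also have "\<dots> = (\<Sum>k\<in>K. \<Sum>k'\<in>K. ee (of_int_vec k \<bullet> y a) * cnj (ee (of_int_vec k' \<bullet> y a)))"
      unfolding F_def cnj_sum by (rule sum_product)
    also have "\<dots> = (\<Sum>k\<in>K. \<Sum>k'\<in>K. ee (of_int_vec (k - k') \<bullet> y a))"
      by (simp add: cnj_ee of_int_vec_diff inner_diff_left flip: ee_add)
    finally show "complex_of_real ((norm (F a))\<^sup>2) = (\<Sum>k\<in>K. \<Sum>k'\<in>K. ee (of_int_vec (k - k') \<bullet> y a))" .
  qed
  also have "\<dots> = (\<Sum>k\<in>K. \<Sum>k'\<in>K. \<Sum>a\<in>S. ee (of_int_vec (k - k') \<bullet> y a))"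
    by (subst sum.swap, rule sum.cong[OF refl], rule sum.swap)
  \<comment> \<open>E is also added on the diagonal, where it is harmless as E >= 0, so that the
    double sum has a closed form.\<close>
  also have "norm \<dots> \<le> (\<Sum>k\<in>K. \<Sum>k'\<in>K. (if k = k' then real (card S) else 0) + E)"
  proof (intro sum_norm_le)
    fix k k' assume kk: "k \<in> K" "k' \<in> K"
    show "norm (\<Sum>a\<in>S. ee (of_int_vec (k - k') \<bullet> y a)) \<le> (if k = k' then real (card S) else 0) + E"
    proof (cases "k = k'")
      case True
      then show ?thesis using norm_sum_ee_le_card[of "\<lambda>a. of_int_vec (k - k') \<bullet> y a" S] E(1) by simp
    next
      case False
      have "\<bar>(k - k') $ j\<bar> < int H" for j
      proof -
        have "0 \<le> k $ j" "k $ j < int H" "0 \<le> k' $ j" "k' $ j < int H" using kk by (auto simp: K_def)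
        then show ?thesis by simp
      qed
      then show ?thesis using E(2)[of "k - k'"] False by simp
    qed
  qed
  also have "\<dots> = real (card K) * real (card S) + real (card K) ^ 2 * E"
    using fK by (simp add: sum.distrib power2_eq_square algebra_simps)
  also have "\<dots> = real (card K) ^ 2 / 4 * (4 * (real (card S) / real (card K) + E))"
    using cK0 by (simp add: power2_eq_square algebra_simps)
  finally have "real (card A) \<le> 4 * (real (card S) / real (card K) + E)"
    using cK0 by (subst (asm) mult_le_cancel_left_pos) auto
  then show ?thesis by (simp add: A_def cK)
qed

text \<open>Two admissible b for the same a would differ by less than 1 in each coordinate because
  the radius is at most 1/2, so b is determined by a and only the points a have to be
  counted.\<close>

lemma near_count_le_card:
  fixes f :: "real^'d \<Rightarrow> real^'m"
  assumes q: "q \<ge> 1" and p: "\<psi> (real q) \<le> 1 / 2"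
  shows "near_count f q \<psi> \<theta> \<le> card {a \<in> {a. shifted_point q (fst \<theta>) a \<in> unit_cube}.
      \<exists>b. infnorm (real q *\<^sub>R f (shifted_point q (fst \<theta>) a) - snd \<theta> - of_int_vec b) < \<psi> (real q)}"
    (is "_ \<le> card ?A")
  unfolding near_count_def
proof (rule card_inj_on_le[where f = fst])
  show "inj_on fst (near_points f q \<psi> \<theta>)"
  proof (rule inj_onI, clarsimp)
    fix a b b' assume ab: "(a, b) \<in> near_points f q \<psi> \<theta>" "(a, b') \<in> near_points f q \<psi> \<theta>"
    let ?y = "real q *\<^sub>R f (shifted_point q (fst \<theta>) a) - snd \<theta>"
    have n: "infnorm (?y - of_int_vec b) < 1 / 2" "infnorm (?y - of_int_vec b') < 1 / 2"
      using ab p by (auto simp: near_points_def)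
    have "b $ j = b' $ j" for j
    proof -
      have "\<bar>(?y - of_int_vec b) $ j\<bar> < 1 / 2" "\<bar>(?y - of_int_vec b') $ j\<bar> < 1 / 2"
        using n component_le_infnorm_cart by (metis le_less_trans)+
      then have "\<bar>?y $ j - real_of_int (b $ j)\<bar> < 1 / 2" "\<bar>?y $ j - real_of_int (b' $ j)\<bar> < 1 / 2"
        by (simp_all only: vector_minus_component of_int_vec_nth)
      then have "\<bar>real_of_int (b $ j) - real_of_int (b' $ j)\<bar> < 1" by argo
      then show ?thesis by linarith
    qed
    then show "b = b'" by (simp add: vec_eq_iff)
  qed
  show "fst ` near_points f q \<psi> \<theta> \<subseteq> ?A" by (auto simp: near_points_def)
  show "finite ?A" by (rule finite_subset[OF _ finite_shifted_points(1)[OF q]]) auto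
qed

(* e k is the k-th coordinate direction of real^'d; pos j is the position of the index j of real^'m. *)
theorem theorem1:
  fixes f :: "real^'d \<Rightarrow> real^'m"
    and e :: "nat \<Rightarrow> 'd"
    and pos :: "'m \<Rightarrow> nat"
    and \<eta> :: real
  assumes "CARD('m) \<le> CARD('d)"
    and "bij_betw e {1..CARD('d)} UNIV"
    and "bij_betw pos UNIV {1..CARD('m)}"
    and "C2_partials_on unit_cube f"
    and "\<eta> > 0"
    and "\<forall>\<alpha>\<in>unit_cube.
           \<bar>det ((\<chi> i j. partial_deriv unit_cube (e 1) (partial_deriv unit_cube (e (pos i)) f) \<alpha> $ j)
                 :: real^'m^'m)\<bar> \<ge> \<eta>"
  shows "\<exists>C>0. \<forall>(\<theta> :: (real^'d) \<times> (real^'m)) (\<psi> :: real \<Rightarrow> real) (q :: nat).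
           (\<forall>r\<ge>0. \<psi> r \<ge> 0) \<longrightarrow> (\<psi> \<longlongrightarrow> 0) at_top \<longrightarrow> q \<ge> 1 \<longrightarrow>
           0 < \<psi> (real q) \<longrightarrow> \<psi> (real q) \<le> 1 / 2 \<longrightarrow>
           real (near_count f q \<psi> \<theta>) \<le>
             C * (\<psi> (real q) ^ CARD('m) * real q ^ CARD('d)
                  + (real q * \<psi> (real q)) powr (- (1 / 2)) * real q ^ CARD('d)
                    * max 1 (ln (real q * \<psi> (real q))))"
proof -
  let ?U = "unit_cube :: (real^'d) set"
  let ?d = "CARD('d)" and ?m = "CARD('m)"
  have "det ((\<chi> i j. partial_deriv ?U (e 1) (partial_deriv ?U (e (pos i)) f) \<alpha> $ j) :: real^'m^'m) \<noteq> 0"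
    if "\<alpha> \<in> ?U" for \<alpha>
    using assms(5,6) that by fastforce
  then obtain C where C: "C \<ge> 0"
    "\<And>(l :: real^'d) (q :: nat) (h :: int^'m). q \<ge> 1 \<Longrightarrow> h \<noteq> 0 \<Longrightarrow>
      norm (\<Sum>a | shifted_point q l a \<in> ?U. ee (real q * (of_int_vec h \<bullet> f (shifted_point q l a))))
        \<le> C * real q ^ (?d - 1) * (sqrt (real q * norm (of_int_vec h)) + norm (of_int_vec h))"
    by (rule exponential_sum_bound[OF assms(4), where k = "e 1" and \<iota> = "\<lambda>i. e (pos i)"]) blast+
  \<comment> \<open>C1 collects the factor 4, the bound (2 q)^d for the number of points and the
    bound (6 m p)^m for 1 / H^m. In C2, 8 C comes from 4 E and 2^d from the trivial bound for r <
    1.\<close>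
  define C1 where "C1 = 4 * 2 ^ ?d * (6 * real ?m) ^ ?m"
  define C2 where "C2 = 8 * C + 2 ^ ?d"
  have pos: "C1 > 0" "C2 > 0" using C(1) by (auto simp: C1_def C2_def intro!: add_nonneg_pos)
  show ?thesis
  proof (intro exI[of _ "C1 + C2"] conjI allI impI)
    show "C1 + C2 > 0" using pos by simp
    fix \<theta> :: "(real^'d) \<times> (real^'m)" and \<psi> :: "real \<Rightarrow> real" and q :: nat
    assume q: "q \<ge> 1" and p0: "0 < \<psi> (real q)" and p1: "\<psi> (real q) \<le> 1 / 2"
    define p where "p = \<psi> (real q)"
    define r where "r = real q * p"
    have p: "0 < p" "p \<le> 1 / 2" and r0: "r > 0" using p0 p1 q by (auto simp: p_def r_def)
    let ?x = "shifted_point q (fst \<theta>)"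
    let ?y = "\<lambda>a. real q *\<^sub>R f (?x a) - snd \<theta>"
    let ?S = "{a. ?x a \<in> ?U}"
    let ?A = "{a\<in>?S. \<exists>b. infnorm (?y a - of_int_vec b) < p}"
    have S: "finite ?S" "real (card ?S) \<le> 2 ^ ?d * real q ^ ?d"
      using finite_shifted_points[OF q, of "fst \<theta>"] by (auto simp: power_mult_distrib)
    have A: "near_count f q \<psi> \<theta> \<le> card ?A"
      using near_count_le_card[where f = f and q = q and \<psi> = \<psi> and \<theta> = \<theta>, OF q p1] by (simp only: p_def)
    have main: "real (near_count f q \<psi> \<theta>) \<le> C1 * (p ^ ?m * real q ^ ?d) + C2 * (real q ^ ?d / sqrt r)"
    proof (cases "r < 1")
      case True
      have "card ?A \<le> card ?S" using S(1) by (intro card_mono) auto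
      then have "real (near_count f q \<psi> \<theta>) \<le> 2 ^ ?d * real q ^ ?d" using A S(2) by linarith
      also have "\<dots> \<le> C2 * (real q ^ ?d / sqrt r)"
      proof (rule mult_mono)
        have "sqrt r \<le> 1" "0 < sqrt r" using True r0 by auto
        then show "real q ^ ?d \<le> real q ^ ?d / sqrt r" by (simp add: divide_simps mult_left_le)
      qed (use C(1) r0 in \<open>auto simp: C2_def\<close>)
      also have "\<dots> \<le> C1 * (p ^ ?m * real q ^ ?d) + C2 * (real q ^ ?d / sqrt r)" using pos p by simp
      finally show ?thesis .
    next
      case False
      \<comment> \<open>The integer H has 1 / (6 m p) between H - 1 and H. The left inequality keeps
        the phases within 1/6, the right one makes 1 / H^m a multiple of p^m. If H = 1, no nonzero
        frequency occurs.\<close>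
      define H where "H = nat \<lfloor>1 / (6 * real ?m * p)\<rfloor> + 1"
      have mp: "6 * real ?m * p > 0" using p by simp
      have H: "real H - 1 \<le> 1 / (6 * real ?m * p)" "1 / (6 * real ?m * p) \<le> real H" "H \<ge> 1"
        using mp unfolding H_def by (simp_all add: of_nat_nat) linarith+
      have mH: "real ?m * (real H - 1) \<le> 1 / (6 * p)"
        using mult_left_mono[OF H(1), of "real ?m"] by (simp add: field_simps)
      define E where "E = 2 * C * (real q ^ ?d / sqrt r)"
      have "real (card ?A) \<le> 4 * (real (card ?S) / real H ^ ?m + E)"
      proof (rule count_near_integers_le[OF S(1) H(3)])
        have "real ?m * (real H - 1) * p \<le> 1 / (6 * p) * p" using mH p by (intro mult_right_mono) auto
        then show "real ?m * (real H - 1) * p \<le> 1 / 6" using p by simp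
        show "E \<ge> 0" using C(1) r0 by (simp add: E_def)
        fix h :: "int^'m" assume h: "h \<noteq> 0" "\<And>j. \<bar>h $ j\<bar> < int H"
        let ?h = "of_int_vec h :: real^'m"
        have "norm ?h \<le> (\<Sum>j\<in>UNIV. \<bar>?h $ j\<bar>)" by (rule norm_le_l1_cart)
        also have "\<dots> \<le> (\<Sum>j\<in>(UNIV::'m set). real H - 1)"
        proof (rule sum_mono)
          fix j
          have "\<bar>h $ j\<bar> \<le> int H - 1" using h(2)[of j] by linarith
          then have "real_of_int \<bar>h $ j\<bar> \<le> real_of_int (int H - 1)" by (simp only: of_int_le_iff)
          then show "\<bar>?h $ j\<bar> \<le> real H - 1" by simp
        qed
        also have "\<dots> \<le> 1 / (6 * p)" using mH by simp
        also have "\<dots> \<le> 1 / p" using p by (intro divide_left_mono) auto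
        finally have nh: "norm ?h \<le> 1 / p" .
        \<comment> \<open>This is r >= 1. Together with |h| <= 1 / p it gives |h|^2 <= q / p, so the
          term |h| of the exponential sum bound is dominated by sqrt (q / p).\<close>
        have pq: "1 / p \<le> real q" using False p by (simp add: r_def field_simps)
        have s1: "sqrt (real q * norm ?h) \<le> sqrt (real q * (1 / p))"
          using nh by (intro real_sqrt_le_mono mult_left_mono) auto
        have "norm ?h = sqrt (norm ?h * norm ?h)" by simp
        also have "\<dots> \<le> sqrt (real q * (1 / p))"
          using nh pq p by (intro real_sqrt_le_mono mult_mono) auto
        finally have s2: "sqrt (real q * norm ?h) + norm ?h \<le> 2 * sqrt (real q * (1 / p))" using s1 by linarith
        have s3: "sqrt (real q * (1 / p)) = real q / sqrt r"
          using q p by (simp add: r_def real_sqrt_mult real_sqrt_divide field_simps)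
        \<comment> \<open>The shift \<open>snd \<theta>\<close> contributes only a unimodular
          factor, and C does not depend on the shift \<open>fst \<theta>\<close> of the lattice;
          hence the uniformity in \<theta>.\<close>
        have "(\<Sum>a\<in>?S. ee (?h \<bullet> ?y a)) = ee (- (?h \<bullet> snd \<theta>)) * (\<Sum>a\<in>?S. ee (real q * (?h \<bullet> f (?x a))))"
          unfolding sum_distrib_left by (simp add: inner_diff_right flip: ee_add)
        then have "norm (\<Sum>a\<in>?S. ee (?h \<bullet> ?y a)) = norm (\<Sum>a\<in>?S. ee (real q * (?h \<bullet> f (?x a))))"
          by (simp only: norm_mult norm_ee mult_1)
        also have "\<dots> \<le> C * real q ^ (?d - 1) * (sqrt (real q * norm ?h) + norm ?h)"
          by (rule C(2)[OF q h(1)])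
        also have "\<dots> \<le> C * real q ^ (?d - 1) * (2 * (real q / sqrt r))"
          using s2 C(1) unfolding s3 by (intro mult_left_mono) auto
        also have "\<dots> = 2 * C * ((real q ^ (?d - 1) * real q) / sqrt r)" by simp
        also have "real q ^ (?d - 1) * real q = real q ^ ?d" by (simp flip: power_Suc2)
        finally show "norm (\<Sum>a\<in>?S. ee (?h \<bullet> ?y a)) \<le> E" by (simp add: E_def)
      qed
      also have "real (card ?S) / real H ^ ?m \<le> 2 ^ ?d * real q ^ ?d * (6 * real ?m * p) ^ ?m"
      proof -
        have "1 / real H \<le> 6 * real ?m * p" using H(2,3) mp by (simp add: field_simps)
        then have "(1 / real H) ^ ?m \<le> (6 * real ?m * p) ^ ?m" by (intro power_mono) auto
        then have "real (card ?S) * (1 / real H) ^ ?m \<le> 2 ^ ?d * real q ^ ?d * (6 * real ?m * p) ^ ?m"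
          using S(2) by (intro mult_mono) auto
        then show ?thesis by (simp add: power_divide)
      qed
      also have "4 * (2 ^ ?d * real q ^ ?d * (6 * real ?m * p) ^ ?m + E)
          = C1 * (p ^ ?m * real q ^ ?d) + 8 * C * (real q ^ ?d / sqrt r)"
        by (simp add: C1_def E_def power_mult_distrib algebra_simps)
      also have "8 * C * (real q ^ ?d / sqrt r) \<le> C2 * (real q ^ ?d / sqrt r)"
        using r0 by (intro mult_right_mono) (auto simp: C2_def)
      finally show ?thesis using A by simp
    qed
    also have "\<dots> \<le> (C1 + C2) * (p ^ ?m * real q ^ ?d + real q ^ ?d / sqrt r * max 1 (ln r))"
    proof -
      define a b M where "a = p ^ ?m * real q ^ ?d" and "b = real q ^ ?d / sqrt r" and "M = max 1 (ln r)"
      have ab: "a \<ge> 0" "b \<ge> 0" "M \<ge> 1" using p r0 by (auto simp: a_def b_def M_def)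
      then have "b \<le> b * M" "0 \<le> b * M" by (auto simp: mult_le_cancel_left1)
      then have "C2 * b \<le> C2 * (b * M)" "0 \<le> C1 * (b * M)" "0 \<le> C2 * a" using ab pos by auto
      then show ?thesis unfolding a_def[symmetric] b_def[symmetric] M_def[symmetric] by (simp add: algebra_simps)
    qed
    also have "real q ^ ?d / sqrt r = r powr (- (1 / 2)) * real q ^ ?d"
      unfolding powr_minus_divide powr_half_sqrt[OF less_imp_le[OF r0]] by simp
    finally show "real (near_count f q \<psi> \<theta>) \<le>
             (C1 + C2) * (\<psi> (real q) ^ CARD('m) * real q ^ CARD('d)
                  + (real q * \<psi> (real q)) powr (- (1 / 2)) * real q ^ CARD('d)
                    * max 1 (ln (real q * \<psi> (real q))))"
      by (simp only: r_def p_def)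
  qed
qed

end
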